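(* Let $F$ be a perfect hyperfield. Then every weak $F$-matroid is a strong $F$-matroid.
   Context: A hyperfield $(F,\odot,\boxplus,1,0)$: $\boxplus$ commutative associative hyperoperation ($x\boxplus y$ non-empty subset, $A\boxplus B=\bigcup a\boxplus b$, iterated sums recursive) with $0\boxplus x=\{x\}$, unique $-x$ with $0\in x\boxplus(-x)$, $x\in y\boxplus z\iff z\in x\boxplus(-y)$; $(F,\odot,1)$ commutative monoid, $0\odot x=0$, distributivity, $0\neq1$, non-zero elements invertible. $F^E$: functions $E\to F$, support $\underline X=\{e:X(e)\neq0\}$. For $\mathcal{C}\subseteq F^E$ consider: (C0) $0\notin\mathcal{C}$; (C1) closure under non-zero scalars; (C2) $\underline X\subseteq\underline Y$ implies $X=\alpha\odot Y$, $\alpha\ne0$; (C3)$'$ if $X,Y\in\mathcal{C}$ form a modular pair and $X(e)=-Y(e)\ne0$ then some $Z\in\mathcal{C}$ has $Z(e)=0$, $Z(f)\in X(f)\boxplus Y(f)$ for all $f$; (C3) if $X_1,\dots,X_k,X\in\mathcal{C}$ ($k\ge1$) form a modular family of size $k+1$, $\underline X\not\subseteq\bigcup\underline X_i$, $e_i\in(\underline X\cap\underline X_i)\setminus\bigcup_{j\ne i}\underline X_j$ with $X(e_i)=-X_i(e_i)\neq0$, then some $Z\in\mathcal{C}$ has $Z(e_i)=0$ for all $i$ and $Z(f)\in X(f)\boxplus X_1(f)\boxplus\cdots\boxplus X_k(f)$ for all $f$. Elements with distinct supports form a modular family of size $k$ if the union of their supports has height $k$ in the lattice of all unions of supports of elements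 of $\mathcal{C}$ ordered by inclusion (height = length of longest strict chain ending at the element); modular pair: $k=2$. A weak (resp. strong) $F$-matroid on a finite set $E$ is a set $\mathcal{C}$ of "$F$-circuits" satisfying (C0),(C1),(C2),(C3)$'$ (resp. (C0)–(C3)). Orthogonality (identity involution): $X\perp Y$ iff $0\in\boxplus_{e}X(e)\odot Y(e)$. For a strong $F$-matroid with $F$-circuits $\mathcal{C}$, its $F$-cocircuits are the elements of minimal support in $\{Y\neq0:Y\perp X\ \forall X\in\mathcal{C}\}$; vectors are elements of $F^E$ orthogonal to all $F$-cocircuits, covectors are elements orthogonal to all $F$-circuits. $F$ is perfect if for every strong $F$-matroid every vector is orthogonal to every covector. *)

theory Defs
  imports Main
begin

class hyperfield = comm_monoid_mult + mult_zero + zero_neq_one + uminus +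
  fixes hadd :: "'a \<Rightarrow> 'a \<Rightarrow> 'a set"  (infixl "\<boxplus>" 65)
  assumes hadd_nonempty: "x \<boxplus> y \<noteq> {}"
    and hadd_commute: "x \<boxplus> y = y \<boxplus> x"
    and hadd_assoc: "(\<Union>w\<in>x \<boxplus> y. w \<boxplus> z) = (\<Union>w\<in>y \<boxplus> z. x \<boxplus> w)"
    and hadd_zero: "0 \<boxplus> x = {x}"
    and hneg_hadd: "0 \<in> x \<boxplus> - x"
    and hneg_unique: "0 \<in> x \<boxplus> y \<Longrightarrow> y = - x"
    and hadd_reversible: "x \<in> y \<boxplus> z \<longleftrightarrow> z \<in> x \<boxplus> - y"
    and hadd_distrib: "(*) a ` (x \<boxplus> y) = a * x \<boxplus> a * y"
    and nonzero_invertible: "x \<noteq> 0 \<Longrightarrow> \<exists>y. x * y = 1"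
begin

definition hadd_set :: "'a set \<Rightarrow> 'a set \<Rightarrow> 'a set"  (infixl "\<boxplus>\<^sub>S" 65)
  where "A \<boxplus>\<^sub>S B = (\<Union>a\<in>A. \<Union>b\<in>B. a \<boxplus> b)"

text \<open>Iterated hypersums over finite index sets, with the empty sum being \<open>{0}\<close>. The summands
  are sets, so a hypersum of elements \<open>x\<^sub>i\<close> is written \<open>hsum (\<lambda>i. {x i}) I\<close>.\<close>

sublocale hsum: comm_monoid_set hadd_set "{0}"
  defines hsum = hsum.F
proof
  show "A \<boxplus>\<^sub>S B \<boxplus>\<^sub>S C = A \<boxplus>\<^sub>S (B \<boxplus>\<^sub>S C)" for A B C
  proof -
    have "A \<boxplus>\<^sub>S B \<boxplus>\<^sub>S C = (\<Union>a\<in>A. \<Union>b\<in>B. \<Union>c\<in>C. \<Union>w\<in>a \<boxplus> b. w \<boxplus> c)"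
      unfolding hadd_set_def by blast
    also have "\<dots> = (\<Union>a\<in>A. \<Union>b\<in>B. \<Union>c\<in>C. \<Union>w\<in>b \<boxplus> c. a \<boxplus> w)"
      by (simp only: hadd_assoc)
    also have "\<dots> = A \<boxplus>\<^sub>S (B \<boxplus>\<^sub>S C)"
      unfolding hadd_set_def by blast
    finally show ?thesis .
  qed
  show "A \<boxplus>\<^sub>S B = B \<boxplus>\<^sub>S A" for A B
    unfolding hadd_set_def using hadd_commute by blast
  show "A \<boxplus>\<^sub>S {0} = A" for A
    unfolding hadd_set_def by (simp add: hadd_commute[of _ 0] hadd_zero)
qed

end

definition supp :: "('e \<Rightarrow> 'f::zero) \<Rightarrow> 'e set"
  where "supp X = {e. X e \<noteq> 0}"

text \<open>Functions \<open>E \<rightarrow> F\<close> are represented by their extension by \<open>0\<close> to the whole type, so that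
  distinct functions on \<open>E\<close> have distinct representatives and the support is a subset of \<open>E\<close>.\<close>

definition funspace :: "'e set \<Rightarrow> ('e \<Rightarrow> 'f::zero) set"
  where "funspace E = {X. supp X \<subseteq> E}"

definition support_unions :: "('e \<Rightarrow> 'f::zero) set \<Rightarrow> 'e set set"
  where "support_unions C = {\<Union>(supp ` S) | S. S \<subseteq> C}"

text \<open>A chain \<open>c 0 \<subset> \<dots> \<subset> c n\<close> has length \<open>n\<close>, so \<open>{}\<close>, the bottom of \<open>support_unions C\<close>, has
  height \<open>0\<close>. The maximum is only meaningful if the lengths are bounded, e.g. if \<open>A\<close> is finite.\<close>

definition height :: "'e set set \<Rightarrow> 'e set \<Rightarrow> nat"
  where "height L A =
    Max {n. \<exists>c::nat \<Rightarrow> 'e set. (\<forall>i\<le>n. c i \<in> L) \<and> (\<forall>i<n. c i \<subset> c (Suc i)) \<and> c n = A}"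

text \<open>The family is given by the set of its members: \<open>card S = k\<close> forces a family of \<open>k\<close>
  elements enumerating \<open>S\<close> to be repetition-free, and \<open>inj_on\<close> makes the supports distinct.\<close>

definition modular_family :: "('e \<Rightarrow> 'f::zero) set \<Rightarrow> nat \<Rightarrow> ('e \<Rightarrow> 'f) set \<Rightarrow> bool"
  where "modular_family C k S \<longleftrightarrow> S \<subseteq> C \<and> finite S \<and> card S = k \<and> inj_on supp S \<and>
    height (support_unions C) (\<Union>(supp ` S)) = k"

definition C0 :: "('e \<Rightarrow> 'f::hyperfield) set \<Rightarrow> bool"
  where "C0 C \<longleftrightarrow> (\<lambda>_. 0) \<notin> C"

definition C1 :: "('e \<Rightarrow> 'f::hyperfield) set \<Rightarrow> bool"
  where "C1 C \<longleftrightarrow> (\<forall>X\<in>C. \<forall>a. a \<noteq> 0 \<longrightarrow> (\<lambda>e. a * X e) \<in> C)"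

definition C2 :: "('e \<Rightarrow> 'f::hyperfield) set \<Rightarrow> bool"
  where "C2 C \<longleftrightarrow> (\<forall>X\<in>C. \<forall>Y\<in>C. supp X \<subseteq> supp Y \<longrightarrow> (\<exists>a. a \<noteq> 0 \<and> X = (\<lambda>e. a * Y e)))"

definition C3_weak :: "('e \<Rightarrow> 'f::hyperfield) set \<Rightarrow> bool"
  where "C3_weak C \<longleftrightarrow>
    (\<forall>X\<in>C. \<forall>Y\<in>C. \<forall>e. modular_family C 2 {X, Y} \<and> X e = - Y e \<and> X e \<noteq> 0 \<longrightarrow>
      (\<exists>Z\<in>C. Z e = 0 \<and> (\<forall>f. Z f \<in> X f \<boxplus> Y f)))"

definition C3 :: "('e \<Rightarrow> 'f::hyperfield) set \<Rightarrow> bool"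
  where "C3 C \<longleftrightarrow>
    (\<forall>k (Xs :: nat \<Rightarrow> 'e \<Rightarrow> 'f) X (e :: nat \<Rightarrow> 'e).
      k \<ge> 1 \<and> (\<forall>i\<in>{1..k}. Xs i \<in> C) \<and> X \<in> C \<and>
      modular_family C (k + 1) (insert X (Xs ` {1..k})) \<and>
      \<not> supp X \<subseteq> (\<Union>i\<in>{1..k}. supp (Xs i)) \<and>
      (\<forall>i\<in>{1..k}. e i \<in> (supp X \<inter> supp (Xs i)) - (\<Union>j\<in>{1..k} - {i}. supp (Xs j)) \<and>
        X (e i) = - Xs i (e i) \<and> X (e i) \<noteq> 0) \<longrightarrow>
      (\<exists>Z\<in>C. (\<forall>i\<in>{1..k}. Z (e i) = 0) \<and>
        (\<forall>f. Z f \<in> {X f} \<boxplus>\<^sub>S hsum (\<lambda>i. {Xs i f}) {1..k})))"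

definition weak_matroid :: "'e set \<Rightarrow> ('e \<Rightarrow> 'f::hyperfield) set \<Rightarrow> bool"
  where "weak_matroid E C \<longleftrightarrow>
    finite E \<and> C \<subseteq> funspace E \<and> C0 C \<and> C1 C \<and> C2 C \<and> C3_weak C"

definition strong_matroid :: "'e set \<Rightarrow> ('e \<Rightarrow> 'f::hyperfield) set \<Rightarrow> bool"
  where "strong_matroid E C \<longleftrightarrow>
    finite E \<and> C \<subseteq> funspace E \<and> C0 C \<and> C1 C \<and> C2 C \<and> C3 C"

definition orthogonal :: "'e set \<Rightarrow> ('e \<Rightarrow> 'f::hyperfield) \<Rightarrow> ('e \<Rightarrow> 'f) \<Rightarrow> bool"
  where "orthogonal E X Y \<longleftrightarrow> 0 \<in> hsum (\<lambda>e. {X e * Y e}) E"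

definition covectors :: "'e set \<Rightarrow> ('e \<Rightarrow> 'f::hyperfield) set \<Rightarrow> ('e \<Rightarrow> 'f) set"
  where "covectors E C = {Y \<in> funspace E. \<forall>X\<in>C. orthogonal E Y X}"

definition cocircuits :: "'e set \<Rightarrow> ('e \<Rightarrow> 'f::hyperfield) set \<Rightarrow> ('e \<Rightarrow> 'f) set"
  where "cocircuits E C = {Y \<in> covectors E C - {\<lambda>_. 0}.
    \<not> (\<exists>Y'\<in>covectors E C - {\<lambda>_. 0}. supp Y' \<subset> supp Y)}"

definition vectors :: "'e set \<Rightarrow> ('e \<Rightarrow> 'f::hyperfield) set \<Rightarrow> ('e \<Rightarrow> 'f) set"
  where "vectors E C = {X \<in> funspace E. \<forall>Y\<in>cocircuits E C. orthogonal E X Y}"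

text \<open>A definition cannot quantify over all types of ground elements. Every finite set is in
  bijection with a finite set of natural numbers, so ground sets \<open>E :: nat set\<close> cover all
  strong matroids up to relabelling.\<close>

definition perfect_hyperfield :: "'f::hyperfield itself \<Rightarrow> bool"
  where "perfect_hyperfield (_ :: 'f itself) \<longleftrightarrow>
    (\<forall>(E :: nat set) (C :: (nat \<Rightarrow> 'f) set). strong_matroid E C \<longrightarrow>
      (\<forall>V\<in>vectors E C. \<forall>W\<in>covectors E C. orthogonal E V W))"

end

theory Submission
  imports Defs
begin

text \<open>
  Supports of the elements of a weak matroid are the circuits of a matroid, and every cocircuit
  of it carries a function that is orthogonal to all \<open>X \<in> C\<close> meeting it in at most three elements;
  let \<open>D\<close> be the set of these functions. The claim is that every \<open>X \<in> C\<close> is orthogonal to every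
  \<open>Y \<in> D\<close>, since strong elimination can be read off from full orthogonality. By induction on the
  size of \<open>S = supp X \<inter> supp Y\<close>: if \<open>card S \<ge> 4\<close>, one can contract \<open>supp X - S\<close>, delete
  \<open>supp Y - S\<close>, and contract or delete the remaining elements outside \<open>S\<close> in such a way that \<open>S\<close> is
  neither a circuit nor a cocircuit of the resulting minor on \<open>S\<close>. By the induction hypothesis this
  minor is a strong matroid, in which \<open>X\<close> restricts to a vector and \<open>Y\<close> to a covector, so they are
  orthogonal because the hyperfield is perfect.
\<close>

section \<open>Arithmetic in hyperfields\<close>

text \<open>The bound three has two sources that happen to meet. On the weak side, circuits that
  leave a hyperplane in two elements fix a function on its complement up to a scalar, and a circuit
  that leaves it in three still lies with two of them in a set of nullity two, where pairs are
  modular. With four elements the nullity is three, beyond the reach of modular pairs, and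
  perfection has to enter. On the minor side, a rank between 2 and \<open>card S - 2\<close>, for
  which \<open>S\<close> is neither a circuit nor a cocircuit, exists exactly from
  \<open>card S = 4\<close> on. The point of such a minor is that each of its circuits and
  cocircuits misses an element of \<open>S\<close>. Every pair of them comes from a pair on
  \<open>E\<close> with fewer common elements, as does every pair of the restriction of
  \<open>X\<close> with a cocircuit or of \<open>Y\<close> with a circuit. Only the pair of the two
  restrictions themselves, both of full support \<open>S\<close>, is out of reach of the induction,
  and that is the pair perfection settles.\<close>

lemma hadd_zero_right [simp]: "(x::'f::hyperfield) \<boxplus> 0 = {x}"
  by (metis hadd_commute hadd_zero)

lemma hadd_zero_left [simp]: "0 \<boxplus> (x::'f::hyperfield) = {x}"
  by (rule hadd_zero)

lemma zero_in_hadd_iff: "0 \<in> (x::'f::hyperfield) \<boxplus> y \<longleftrightarrow> y = - x"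
  using hneg_hadd hneg_unique by blast

lemma hneg_hneg [simp]: "- (- x) = (x::'f::hyperfield)"
  by (metis hadd_commute zero_in_hadd_iff)

lemma hneg_zero [simp]: "- 0 = (0::'f::hyperfield)"
  by (metis hadd_zero_left insertI1 zero_in_hadd_iff)

lemma mult_hneg_right: "(a::'f::hyperfield) * - b = - (a * b)"
proof -
  have "a * 0 \<in> (*) a ` (b \<boxplus> - b)" using hneg_hadd by blast
  then show ?thesis by (simp add: hadd_distrib zero_in_hadd_iff)
qed

lemma mult_hneg_left: "- (a::'f::hyperfield) * b = - (a * b)"
  by (metis mult.commute mult_hneg_right)

lemma hneg_eq_zero_iff [simp]: "- (x::'f::hyperfield) = 0 \<longleftrightarrow> x = 0"
  by (metis hneg_hneg hneg_zero)

lemma hneg_hadd_distrib: "uminus ` (x \<boxplus> y) = - x \<boxplus> - (y::'f::hyperfield)"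
proof -
  have "uminus = (*) (- 1 :: 'f)" by (auto simp: mult_hneg_left)
  then show ?thesis by (metis hadd_distrib)
qed

lemma hmult_cancel: "(a::'f::hyperfield) \<noteq> 0 \<Longrightarrow> a * x = a * y \<longleftrightarrow> x = y"
  by (metis mult.assoc mult.commute mult_1 nonzero_invertible)

lemma hmult_eq_zero_iff [simp]: "(a::'f::hyperfield) * x = 0 \<longleftrightarrow> a = 0 \<or> x = 0"
  by (metis hmult_cancel mult_zero_left mult_zero_right)

lemma ex_mult_eq: "(a::'f::hyperfield) \<noteq> 0 \<Longrightarrow> \<exists>c. c * a = b"
  by (metis mult.assoc mult.commute mult_1 nonzero_invertible)

lemma hadd_set_singleton [simp]: "{x::'f::hyperfield} \<boxplus>\<^sub>S {y} = x \<boxplus> y"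
  by (simp add: hadd_set_def)

lemma hadd_set_zero [simp]: "A \<boxplus>\<^sub>S {0} = A" "{0} \<boxplus>\<^sub>S A = (A::'f::hyperfield set)"
  by (auto simp: hadd_set_def)

lemma hadd_set_distrib: "(*) (a::'f::hyperfield) ` (A \<boxplus>\<^sub>S B) = (*) a ` A \<boxplus>\<^sub>S (*) a ` B"
  by (simp add: hadd_set_def image_UN hadd_distrib)

lemma hsum_distrib:
  fixes g :: "'i \<Rightarrow> 'f::hyperfield"
  shows "(*) a ` hsum (\<lambda>i. {g i}) I = hsum (\<lambda>i. {a * g i}) I"
  by (induction I rule: infinite_finite_induct) (auto simp: hadd_set_distrib)

lemma zero_in_hadd_set_singleton:
  "0 \<in> {x::'f::hyperfield} \<boxplus>\<^sub>S A \<longleftrightarrow> - x \<in> A"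
  by (auto simp: hadd_set_def zero_in_hadd_iff)

section \<open>Orthogonality\<close>

lemma orthogonal_commute: "orthogonal E X Y \<longleftrightarrow> orthogonal E Y X"
  by (simp add: orthogonal_def mult.commute)

lemma orthogonal_scale:
  assumes "orthogonal E X Y"
  shows "orthogonal E (\<lambda>e. a * X e) Y"
proof -
  have "a * 0 \<in> (*) a ` hsum (\<lambda>e. {X e * Y e}) E"
    using assms unfolding orthogonal_def by blast
  then show ?thesis
    by (simp add: hsum_distrib orthogonal_def mult.assoc)
qed

lemma orthogonal_restrict:
  assumes "finite E" "S \<subseteq> E" "supp X \<inter> supp Y \<subseteq> S"
  shows "orthogonal E X Y \<longleftrightarrow> orthogonal S X Y"
proof -
  have "hsum (\<lambda>e. {X e * Y e}) E = hsum (\<lambda>e. {X e * Y e}) S"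
    by (rule hsum.mono_neutral_right) (use assms in \<open>auto simp: supp_def\<close>)
  then show ?thesis by (simp add: orthogonal_def)
qed

text \<open>A two-term hypersum contains 0 for exactly one value of the second term, so with two
  common elements orthogonality is an equation. Ratios of values are compared through it.\<close>

lemma orthogonal_pair:
  assumes "finite E" "e \<in> E" "f \<in> E" "e \<noteq> f" "supp X \<inter> supp Y \<subseteq> {e, f}"
  shows "orthogonal E X Y \<longleftrightarrow> X e * Y e = - (X f * Y f)"
proof -
  have "orthogonal E X Y \<longleftrightarrow> orthogonal {e, f} X Y"
    using assms by (intro orthogonal_restrict) auto
  also have "\<dots> \<longleftrightarrow> 0 \<in> X f * Y f \<boxplus> X e * Y e"
    using assms by (simp add: orthogonal_def hadd_commute)
  finally show ?thesis by (simp add: zero_in_hadd_iff)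
qed

text \<open>A hypersum with one non-zero term is the singleton of that term. On supports this is the
  matroid fact that a circuit and a cocircuit never meet in one element.\<close>

lemma orthogonal_neq_singleton:
  assumes "finite E" "X \<in> funspace E" "orthogonal E X Y"
  shows "supp X \<inter> supp Y \<noteq> {e}"
proof
  assume e: "supp X \<inter> supp Y = {e}"
  then have "orthogonal {e} X Y"
    using orthogonal_restrict[of E "{e}" X Y] assms by (auto simp: funspace_def)
  with e show False by (auto simp: orthogonal_def supp_def)
qed

lemma supp_scale: "(a::'f::hyperfield) \<noteq> 0 \<Longrightarrow> supp (\<lambda>e. a * X e) = supp X"
  by (simp add: supp_def)

lemma supp_eq_empty: "supp X = {} \<longleftrightarrow> X = (\<lambda>_. 0)"
  by (auto simp: supp_def)

section \<open>The painting property\<close>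

text \<open>Minty's characterisation of dual pairs of matroids. It has the advantage that it passes
  to minors and to elements of minimal support without any use of bases or rank.\<close>

definition painting :: "'e set \<Rightarrow> ('e \<Rightarrow> 'f::zero) set \<Rightarrow> ('e \<Rightarrow> 'f) set \<Rightarrow> bool"
  where "painting E C D \<longleftrightarrow> (\<forall>e\<in>E. \<forall>R. e \<notin> R \<longrightarrow>
    (\<exists>X\<in>C. e \<in> supp X \<and> supp X \<subseteq> insert e R) \<or> (\<exists>Y\<in>D. e \<in> supp Y \<and> supp Y \<inter> R = {}))"

text \<open>Restricting circuits to a minor may produce zero and supports that are not minimal; the
  circuits of the minor are what remains here.\<close>

definition minsupp :: "('e \<Rightarrow> 'f::zero) set \<Rightarrow> ('e \<Rightarrow> 'f) set"
  where "minsupp C = {X \<in> C - {\<lambda>_. 0}. \<not> (\<exists>X'\<in>C - {\<lambda>_. 0}. supp X' \<subset> supp X)}"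

lemma paintingD:
  assumes "painting E C D" "e \<in> E" "e \<notin> R"
  obtains X where "X \<in> C" "e \<in> supp X" "supp X \<subseteq> insert e R"
    | Y where "Y \<in> D" "e \<in> supp Y" "supp Y \<inter> R = {}"
  using assms unfolding painting_def by blast

lemma painting_swap:
  assumes "C \<subseteq> funspace E" "D \<subseteq> funspace E" "painting E C D"
  shows "painting E D C"
  unfolding painting_def
proof (intro ballI allI impI)
  fix e R assume e: "e \<in> E" "e \<notin> R"
  \<comment> \<open>Duality exchanges the two colour classes of the painting.\<close>
  have "e \<notin> E - R - {e}" by simp
  from assms(3) e(1) this show "(\<exists>X\<in>D. e \<in> supp X \<and> supp X \<subseteq> insert e R) \<or> (\<exists>Y\<in>C. e \<in> supp Y \<and> supp Y \<inter> R = {})"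
  proof (cases rule: paintingD)
    case (1 X)
    then show ?thesis using e by blast
  next
    case (2 Y)
    with assms(2) have "supp Y \<subseteq> insert e R" by (auto simp: funspace_def)
    with 2 show ?thesis by blast
  qed
qed

text \<open>A smallest \<open>X\<close> among the candidates through \<open>e\<close> is minimal
  altogether. A smaller non-zero \<open>X1\<close> would avoid \<open>e\<close>; for
  \<open>f\<close> in its support, painting \<open>e\<close> against \<open>supp X - {e, f}\<close>
  gives a smaller candidate or a \<open>Y\<close> that meets \<open>X\<close> in
  \<open>{e, f}\<close> and hence \<open>X1\<close> in \<open>f\<close> alone.\<close>

lemma painting_minsupp:
  assumes "finite E" "C \<subseteq> funspace E" "painting E C D"
    and not1: "\<And>X Y e. X \<in> C \<Longrightarrow> Y \<in> D \<Longrightarrow> supp X \<inter> supp Y \<noteq> {e}"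
  shows "painting E (minsupp C) D"
  unfolding painting_def
proof (intro ballI allI impI)
  fix e R assume e: "e \<in> E" "e \<notin> R"
  let ?P = "\<lambda>X. X \<in> C \<and> e \<in> supp X \<and> supp X \<subseteq> insert e R"
  show "(\<exists>X\<in>minsupp C. e \<in> supp X \<and> supp X \<subseteq> insert e R) \<or> (\<exists>Y\<in>D. e \<in> supp Y \<and> supp Y \<inter> R = {})"
  proof (cases "\<exists>X. ?P X")
    case False
    then show ?thesis using paintingD[OF assms(3) e] by metis
  next
    case True
    define X where "X = (ARG_MIN (\<lambda>X. card (supp X)) X. ?P X)"
    from True obtain X0 where "?P X0" by blast
    then have X: "?P X"
      unfolding X_def by (rule arg_min_natI[of ?P])
    have X_min: "\<not> supp X' \<subset> supp X" if "?P X'" for X'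
    proof
      assume "supp X' \<subset> supp X"
      moreover have "finite (supp X)"
        using X assms(1,2) by (auto simp: funspace_def intro: finite_subset)
      ultimately have "card (supp X') < card (supp X)" by (simp add: psubset_card_mono)
      moreover have "card (supp X) \<le> card (supp X')"
        unfolding X_def using that by (rule arg_min_nat_le[of ?P])
      ultimately show False by simp
    qed
    have "\<not> supp X1 \<subset> supp X" if X1: "X1 \<in> C" "X1 \<noteq> (\<lambda>_. 0)" for X1
    proof
      assume sub: "supp X1 \<subset> supp X"
      have "e \<notin> supp X1" using X_min[of X1] X X1 sub by blast
      obtain f where f: "f \<in> supp X1" using X1 supp_eq_empty by blast
      have "e \<notin> supp X - {e, f}" by simp
      with assms(3) e(1) show False
      proof (cases rule: paintingD)
        case (1 X2)
        then have "?P X2" "supp X2 \<subset> supp X" using X f \<open>e \<notin> supp X1\<close> sub by blast+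
        then show False using X_min by blast
      next
        case (2 Y)
        then have "supp X \<inter> supp Y \<subseteq> {e, f}" "e \<in> supp X \<inter> supp Y" using X by auto
        with not1[of X Y e] X 2 have "f \<in> supp Y" by blast
        then have "supp X1 \<inter> supp Y = {f}" using 2 f sub \<open>e \<notin> supp X1\<close> by blast
        then show False using not1 X1 2 by blast
      qed
    qed
    moreover have "X \<noteq> (\<lambda>_. 0)" using X by (auto simp: supp_def)
    ultimately have "X \<in> minsupp C" using X by (auto simp: minsupp_def)
    then show ?thesis using X by blast
  qed
qed

section \<open>Circuit elimination\<close>

lemma finite_maximal_set:
  assumes "finite \<F>" "A \<in> \<F>"
  obtains M where "M \<in> \<F>" "\<And>M'. M' \<in> \<F> \<Longrightarrow> M \<subseteq> M' \<Longrightarrow> M = M'"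
  using finite_has_maximal[of \<F>] assms by blast

locale circuit_system =
  fixes E :: "'e set" and K :: "'e set set"
  assumes finite_E: "finite E"
    and K_sub: "A \<in> K \<Longrightarrow> A \<subseteq> E"
    and K_nonempty: "A \<in> K \<Longrightarrow> A \<noteq> {}"
    and clutter: "A \<in> K \<Longrightarrow> B \<in> K \<Longrightarrow> A \<subseteq> B \<Longrightarrow> A = B"
    and elim: "A \<in> K \<Longrightarrow> B \<in> K \<Longrightarrow> A \<noteq> B \<Longrightarrow> e \<in> A \<inter> B \<Longrightarrow> \<exists>Z\<in>K. Z \<subseteq> A \<union> B - {e}"
begin

lemma finite_circuit: "A \<in> K \<Longrightarrow> finite A"
  using K_sub finite_E finite_subset by blast

text \<open>If weak elimination gives \<open>Z1\<close> without \<open>f\<close>, then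
  \<open>Z1\<close> contains some \<open>g\<close> of \<open>B\<close> outside \<open>A\<close>.
  Eliminating \<open>g\<close> from \<open>B\<close> and \<open>Z1\<close> while keeping
  \<open>e\<close>, and then \<open>e\<close> from \<open>A\<close> and the result while keeping
  \<open>f\<close>, uses two smaller unions: the first lacks \<open>f\<close>, the second
  \<open>g\<close>.\<close>

lemma strong_elim:
  assumes "A \<in> K" "B \<in> K" "e \<in> A" "e \<in> B" "f \<in> A" "f \<notin> B"
  obtains Z where "Z \<in> K" "f \<in> Z" "Z \<subseteq> A \<union> B - {e}"
proof -
  have "\<exists>Z\<in>K. f \<in> Z \<and> Z \<subseteq> A \<union> B - {e}"
    using assms
  proof (induction "card (A \<union> B)" arbitrary: A B e f rule: less_induct)
    case less
    from less.prems obtain Z1 where Z1: "Z1 \<in> K" "Z1 \<subseteq> A \<union> B - {e}"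
      using elim[of A B e] by blast
    show ?case
    proof (cases "f \<in> Z1")
      case False
      have "\<not> Z1 \<subseteq> A" using clutter[of Z1 A] Z1 less.prems by blast
      then obtain g where g: "g \<in> Z1" "g \<in> B" "g \<notin> A" using Z1 by blast
      have fin: "finite (A \<union> B)" using finite_circuit less.prems by blast
      have "B \<union> Z1 \<subset> A \<union> B" using Z1 False less.prems by blast
      then have "card (B \<union> Z1) < card (A \<union> B)" using fin by (simp add: psubset_card_mono)
      from less.hyps[OF this, of g e] obtain Z2
        where Z2: "Z2 \<in> K" "e \<in> Z2" "Z2 \<subseteq> B \<union> Z1 - {g}"
        using less.prems Z1 g by blast
      have "A \<union> Z2 \<subset> A \<union> B" using Z2 Z1 g by blast
      then have "card (A \<union> Z2) < card (A \<union> B)" using fin by (simp add: psubset_card_mono)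
      from less.hyps[OF this, of e f] obtain Z3
        where "Z3 \<in> K" "f \<in> Z3" "Z3 \<subseteq> A \<union> Z2 - {e}"
        using less.prems Z2 Z1 False by blast
      then show ?thesis using Z2 Z1 by blast
    qed (use Z1 in blast)
  qed
  then show ?thesis using that by blast
qed

section \<open>Independent sets, fundamental circuits and bases\<close>

definition indep :: "'e set \<Rightarrow> bool"
  where "indep I \<longleftrightarrow> (\<forall>A\<in>K. \<not> A \<subseteq> I)"

text \<open>This is the fundamental circuit of \<open>f\<close>: both circuits contain
  \<open>f\<close>, and eliminating it would leave a circuit inside \<open>I\<close>.\<close>

lemma circuit_unique:
  assumes "indep I" "A \<in> K" "B \<in> K" "A \<subseteq> insert f I" "B \<subseteq> insert f I"
  shows "A = B"
proof (rule ccontr)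
  assume "A \<noteq> B"
  moreover have "f \<in> A" "f \<in> B" using assms unfolding indep_def by blast+
  ultimately obtain Z where "Z \<in> K" "Z \<subseteq> A \<union> B - {f}" using assms elim by blast
  then show False using assms unfolding indep_def by blast
qed

text \<open>\<open>I \<union> {f, g}\<close> has nullity at most two, so any two of its circuits form a modular pair.\<close>

lemma circuit_subset_Un:
  assumes I: "indep I" and "A \<in> K" "B \<in> K" "X \<in> K" and "A \<noteq> B"
    and sub: "A \<subseteq> insert f (insert g I)" "B \<subseteq> insert f (insert g I)" "X \<subseteq> insert f (insert g I)"
  shows "X \<subseteq> A \<union> B"
proof
  fix v assume v: "v \<in> X"
  show "v \<in> A \<union> B"
  proof (rule ccontr)
    assume vn: "v \<notin> A \<union> B"
    \<comment> \<open>Eliminating \<open>h'\<close> from \<open>A\<close> and \<open>B\<close>, or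
      taking the one without \<open>h'\<close>, shows that the fundamental circuits of
      \<open>f\<close> and of \<open>g\<close> avoid \<open>v\<close>. Clearing \<open>f\<close>
      from \<open>X\<close> while keeping \<open>v\<close> then yields a second fundamental circuit
      of \<open>g\<close>.\<close>
    have avoid: "\<exists>Z\<in>K. v \<notin> Z \<and> Z \<subseteq> insert h I" if fg: "{f, g} = {h, h'}" for h h'
    proof -
      have sub': "A \<subseteq> insert h' (insert h I)" "B \<subseteq> insert h' (insert h I)"
        using sub fg by blast+
      show ?thesis
      proof (cases "h' \<in> A \<and> h' \<in> B")
        case True
        then obtain Z where "Z \<in> K" "Z \<subseteq> A \<union> B - {h'}"
          using elim[of A B h'] assms(2,3,5) by blast
        moreover from this have "v \<notin> Z" "Z \<subseteq> insert h I" using vn sub' by blast+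
        ultimately show ?thesis by blast
      next
        case False
        then show ?thesis using assms(2,3) vn sub' by blast
      qed
    qed
    obtain Zf where Zf: "Zf \<in> K" "v \<notin> Zf" "Zf \<subseteq> insert f I" using avoid[of f g] by blast
    obtain Zg where Zg: "Zg \<in> K" "v \<notin> Zg" "Zg \<subseteq> insert g I" using avoid[of g f] by blast
    have fZf: "f \<in> Zf" using I Zf unfolding indep_def by blast
    show False
    proof (cases "f \<in> X")
      case True
      then obtain Z where Z: "Z \<in> K" "v \<in> Z" "Z \<subseteq> X \<union> Zf - {f}"
        using strong_elim[of X Zf f v] assms(4) Zf fZf v by blast
      then have "Z \<subseteq> insert g I" using sub Zf by blast
      then show False using circuit_unique[OF I \<open>Z \<in> K\<close> \<open>Zg \<in> K\<close>] Zg Z by blast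
    next
      case False
      then have "X \<subseteq> insert g I" using sub by blast
      then show False using circuit_unique[OF I \<open>X \<in> K\<close> \<open>Zg \<in> K\<close>] Zg v by blast
    qed
  qed
qed

text \<open>A basis of the restriction to \<open>H\<close>, with maximality phrased as the existence
  of fundamental circuits, which are what eliminations use.\<close>

definition spanning_indep :: "'e set \<Rightarrow> 'e set \<Rightarrow> bool"
  where "spanning_indep H B \<longleftrightarrow> B \<subseteq> H \<and> indep B \<and> (\<forall>h\<in>H - B. \<exists>A\<in>K. A \<subseteq> insert h B)"

lemma spanning_indep_extend:
  assumes "indep I" "I \<subseteq> H" "H \<subseteq> E"
  obtains B where "spanning_indep H B" "I \<subseteq> B"
proof -
  define F where "F = {B. I \<subseteq> B \<and> B \<subseteq> H \<and> indep B}"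
  have "finite F" using assms finite_E
    by (intro finite_subset[of F "Pow E"]) (auto simp: F_def)
  moreover have "I \<in> F" using assms by (simp add: F_def)
  ultimately obtain B where B: "B \<in> F" "\<And>B'. B' \<in> F \<Longrightarrow> B \<subseteq> B' \<Longrightarrow> B = B'"
    by (rule finite_maximal_set) blast
  have "\<exists>A\<in>K. A \<subseteq> insert h B" if "h \<in> H - B" for h
  proof (rule ccontr)
    assume "\<not> ?thesis"
    then have "insert h B \<in> F" using B(1) that unfolding indep_def F_def by blast
    then show False using B(2)[of "insert h B"] that by blast
  qed
  then show ?thesis using that B(1) unfolding spanning_indep_def F_def by blast
qed

text \<open>Elements of \<open>A\<close> in \<open>H\<close> but outside \<open>B\<close> are
  eliminated one at a time with their fundamental circuits over \<open>B\<close>. These lie in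
  \<open>H\<close> and so never contain \<open>e\<close>, which can therefore be kept.\<close>

lemma circuit_into_basis:
  assumes B: "spanning_indep H B" and "A \<in> K" "e \<in> A" "e \<notin> H"
  obtains A' where "A' \<in> K" "e \<in> A'" "A' \<subseteq> B \<union> (A - H)"
proof -
  have "\<exists>A'\<in>K. e \<in> A' \<and> A' \<subseteq> B \<union> (A - H)"
    using assms(2,3)
  proof (induction "card (A \<inter> H - B)" arbitrary: A rule: less_induct)
    case less
    show ?case
    proof (cases "A \<inter> H \<subseteq> B")
      case False
      then obtain c where c: "c \<in> A" "c \<in> H" "c \<notin> B" by blast
      with B obtain X where X: "X \<in> K" "X \<subseteq> insert c B"
        unfolding spanning_indep_def by blast
      have cX: "c \<in> X" using B X unfolding spanning_indep_def indep_def by blast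
      have eX: "e \<notin> X" using X c B assms(4) unfolding spanning_indep_def by blast
      obtain Z where Z: "Z \<in> K" "e \<in> Z" "Z \<subseteq> A \<union> X - {c}"
        using strong_elim[of A X c e] less.prems c X cX eX by blast
      have "Z \<inter> H - B \<subset> A \<inter> H - B" using Z X c by blast
      then have "card (Z \<inter> H - B) < card (A \<inter> H - B)"
        using finite_circuit[OF less.prems(1)] by (simp add: psubset_card_mono)
      from less.hyps[OF this Z(1,2)] obtain A' where
        "A' \<in> K" "e \<in> A'" "A' \<subseteq> B \<union> (Z - H)" by blast
      moreover have "Z - H \<subseteq> A - H"
        using Z X c B unfolding spanning_indep_def by blast
      ultimately show ?thesis by blast
    qed (use less.prems in blast)
  qed
  then show ?thesis using that by blast
qed

text \<open>The fundamental circuit of \<open>c\<close> over \<open>B\<close> is not contained in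
  the independent \<open>B'\<close>; any of its elements outside \<open>B'\<close> can leave the
  basis.\<close>

lemma spanning_indep_exchange:
  assumes B: "spanning_indep H B" and B': "spanning_indep H B'" and c: "c \<in> B' - B"
  obtains b where "b \<in> B - B'" "spanning_indep H (insert c (B - {b}))"
proof -
  have BH: "B \<subseteq> H" "indep B" "B' \<subseteq> H" "indep B'"
    using B B' unfolding spanning_indep_def by auto
  obtain X where X: "X \<in> K" "X \<subseteq> insert c B"
    using B c BH unfolding spanning_indep_def by blast
  have cX: "c \<in> X" using X BH unfolding indep_def by blast
  obtain b where b: "b \<in> X" "b \<notin> B'" using X BH unfolding indep_def by blast
  then have bB: "b \<in> B" "b \<noteq> c" using X c by auto
  let ?B = "insert c (B - {b})"
  have "indep ?B"
    unfolding indep_def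
  proof (intro ballI notI)
    fix A assume A: "A \<in> K" "A \<subseteq> ?B"
    then have "A \<subseteq> insert c B" by blast
    then have "A = X" using circuit_unique[OF \<open>indep B\<close>] A X by blast
    then show False using A b bB by blast
  qed
  moreover have "\<exists>A\<in>K. A \<subseteq> insert h ?B" if h: "h \<in> H - ?B" for h
  proof (cases "h = b")
    case True
    then show ?thesis using X by blast
  next
    case False
    then obtain A where A: "A \<in> K" "A \<subseteq> insert h B"
      using B h unfolding spanning_indep_def by blast
    have hA: "h \<in> A" using A BH unfolding indep_def by blast
    show ?thesis
    proof (cases "b \<in> A")
      case True
      have "h \<notin> X" using h False X by blast
      then obtain Z where "Z \<in> K" "Z \<subseteq> A \<union> X - {b}"
        using strong_elim[OF A(1) X(1) True b(1) hA] by blast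
      then show ?thesis using A X by blast
    qed (use A in blast)
  qed
  ultimately have "spanning_indep H ?B"
    using BH c unfolding spanning_indep_def by blast
  then show ?thesis using that b bB by blast
qed

text \<open>The hypothesis \<open>closed\<close> says that \<open>H\<close> is a flat. Moving the
  circuit into \<open>B\<close> keeps \<open>f\<close>, and \<open>g\<close> cannot get lost, since
  the circuit would then leave \<open>H\<close> in \<open>f\<close> alone.\<close>

lemma circuit_pair_basis:
  assumes closed: "\<And>A f. A \<in> K \<Longrightarrow> A - H \<noteq> {f}"
    and B: "spanning_indep H B" and A: "A \<in> K" "A - H = {f, g}"
  obtains A' where "A' \<in> K" "A' - H = {f, g}" "A' \<subseteq> insert f (insert g B)"
proof -
  have BH: "B \<subseteq> H" using B unfolding spanning_indep_def by blast
  obtain A' where A': "A' \<in> K" "f \<in> A'" "A' \<subseteq> B \<union> (A - H)"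
    using circuit_into_basis[OF B A(1), of f] A by blast
  have "A' - H \<subseteq> {f, g}" "f \<in> A' - H" using A' A BH by blast+
  then have "A' - H = {f, g}" using closed[OF A'(1), of f] by blast
  then show ?thesis using that A' A by auto
qed

lemma indep_insert_closed:
  assumes closed: "\<And>A f. A \<in> K \<Longrightarrow> A - H \<noteq> {f}"
    and B: "spanning_indep H B" and "f \<notin> H"
  shows "indep (insert f B)"
  unfolding indep_def
proof (intro ballI notI)
  fix A assume A: "A \<in> K" "A \<subseteq> insert f B"
  have "\<not> A \<subseteq> B" using A B unfolding spanning_indep_def indep_def by blast
  then have "A - H = {f}" using A B assms(3) unfolding spanning_indep_def by blast
  then show False using closed A by blast
qed

text \<open>\<open>H\<close> is the hyperplane complementary to a cocircuit through \<open>e\<close> that avoids \<open>R\<close>.\<close>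

lemma hyperplane_exists:
  assumes "e \<in> E" "e \<notin> R" and no: "\<And>A. A \<in> K \<Longrightarrow> e \<in> A \<Longrightarrow> \<not> A \<subseteq> insert e R"
  obtains H where "H \<subseteq> E" "R \<inter> E \<subseteq> H" "e \<notin> H"
    "\<And>A f. A \<in> K \<Longrightarrow> A - H \<noteq> {f}"
    "\<And>f. f \<in> E - H - {e} \<Longrightarrow> \<exists>A\<in>K. A - H = {e, f}"
proof -
  \<comment> \<open>These are the sets around \<open>R\<close> that do not span \<open>e\<close>; a
    maximal one is a hyperplane.\<close>
  define F where "F = {H. R \<inter> E \<subseteq> H \<and> H \<subseteq> E \<and> e \<notin> H \<and> (\<forall>A\<in>K. e \<in> A \<longrightarrow> \<not> A \<subseteq> insert e H)}"
  have "finite F" using finite_E by (intro finite_subset[of F "Pow E"]) (auto simp: F_def)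
  moreover have "R \<inter> E \<in> F" using assms by (auto simp: F_def)
  ultimately obtain H where H: "H \<in> F" "\<And>H'. H' \<in> F \<Longrightarrow> H \<subseteq> H' \<Longrightarrow> H = H'"
    by (rule finite_maximal_set) blast
  have H_props: "R \<inter> E \<subseteq> H" "H \<subseteq> E" "e \<notin> H" and no_H: "\<And>A. A \<in> K \<Longrightarrow> e \<in> A \<Longrightarrow> \<not> A \<subseteq> insert e H"
    using H(1) by (auto simp: F_def)
  have through: "\<exists>A\<in>K. e \<in> A \<and> f \<in> A \<and> A \<subseteq> insert e (insert f H)" if "f \<in> E - H - {e}" for f
  proof (rule ccontr)
    assume "\<not> ?thesis"
    then have "insert f H \<in> F" using H(1) that unfolding F_def by blast
    then show False using H(2)[of "insert f H"] that by blast
  qed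
  have "A - H \<noteq> {f}" if A: "A \<in> K" for A f
  proof
    assume f: "A - H = {f}"
    then have "A \<subseteq> insert f H" "e \<in> A \<Longrightarrow> e = f" using H_props(3) by auto
    then have "e \<notin> A" using no_H[OF A] by blast
    then obtain A' where A': "A' \<in> K" "e \<in> A'" "f \<in> A'" "A' \<subseteq> insert e (insert f H)"
      using through[of f] f K_sub[OF A] by blast
    then obtain Z where "Z \<in> K" "e \<in> Z" "Z \<subseteq> A' \<union> A - {f}"
      using strong_elim[of A' A f e] A f \<open>e \<notin> A\<close> by blast
    then show False using no_H A' f by blast
  qed
  moreover have "\<exists>A\<in>K. A - H = {e, f}" if f: "f \<in> E - H - {e}" for f
  proof -
    obtain A where A: "A \<in> K" "e \<in> A" "f \<in> A" "A \<subseteq> insert e (insert f H)"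
      using through[OF f] by blast
    then have "A - H = {e, f}" using f H_props(3) by auto
    with A show ?thesis by blast
  qed
  ultimately show ?thesis by (rule that[OF H_props(2,1,3)])
qed

end

section \<open>Weak matroids\<close>

text \<open>In a chain of length three below the union, the member after the bottom contains a
  support \<open>A\<close>, and the next one a support \<open>B\<close> that is not inside the
  former. Their union would be strictly smaller than that of \<open>X\<close> and
  \<open>Y\<close>.\<close>

lemma modular_pairI:
  assumes X: "X \<in> C" "supp X \<noteq> {}" and Y: "Y \<in> C" "\<not> supp Y \<subseteq> supp X" "supp X \<noteq> supp Y"
    and no: "\<And>A B. A \<in> C \<Longrightarrow> B \<in> C \<Longrightarrow> supp A \<noteq> supp B \<Longrightarrow>
      \<not> supp A \<union> supp B \<subset> supp X \<union> supp Y"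
  shows "modular_family C 2 {X, Y}"
proof -
  let ?L = "support_unions C" and ?U = "supp X \<union> supp Y"
  let ?N = "{n. \<exists>c::nat \<Rightarrow> _. (\<forall>i\<le>n. c i \<in> ?L) \<and> (\<forall>i<n. c i \<subset> c (Suc i)) \<and> c n = ?U}"
  have upper: "n \<le> 2" if "n \<in> ?N" for n
  proof (rule ccontr)
    assume n: "\<not> n \<le> 2"
    from that obtain c where c: "\<And>i. i \<le> n \<Longrightarrow> c i \<in> ?L" "\<And>i. i < n \<Longrightarrow> c i \<subset> c (Suc i)" "c n = ?U"
      by blast
    have step: "c j \<subseteq> c n" if "j \<le> n" for j
      using that by (induction rule: inc_induct) (use c(2) in blast)+
    have "c (Suc 0) \<noteq> {}" using c(2)[of 0] n by auto
    moreover obtain S1 where S1: "S1 \<subseteq> C" "c (Suc 0) = \<Union>(supp ` S1)"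
      using c(1)[of "Suc 0"] n by (auto simp: support_unions_def)
    ultimately obtain A where A: "A \<in> C" "supp A \<subseteq> c (Suc 0)" by blast
    obtain S2 where S2: "S2 \<subseteq> C" "c 2 = \<Union>(supp ` S2)"
      using c(1)[of 2] n by (auto simp: support_unions_def)
    have "c (Suc 0) \<subset> c 2" using c(2)[of "Suc 0"] n by (simp add: numeral_2_eq_2)
    then have "\<not> \<Union>(supp ` S2) \<subseteq> c (Suc 0)" using S2 by auto
    then obtain B where "B \<in> S2" "\<not> supp B \<subseteq> c (Suc 0)" by blast
    with S2 have B: "B \<in> C" "supp B \<subseteq> c 2" "\<not> supp B \<subseteq> c (Suc 0)" by auto
    have "c 2 \<subset> c (Suc 2)" using c(2)[of 2] n by simp
    also have "\<dots> \<subseteq> ?U" using step[of "Suc 2"] c(3) n by simp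
    finally have "supp A \<union> supp B \<subset> ?U" using A B \<open>c (Suc 0) \<subset> c 2\<close> by blast
    then show False using no A B by metis
  qed
  have "2 \<in> ?N"
  proof -
    define c where "c i = (if i = 0 then {} else if i = Suc 0 then supp X else ?U)" for i :: nat
    have "{} \<in> ?L" "supp X \<in> ?L" "?U \<in> ?L"
      unfolding support_unions_def using X Y
      by (auto intro: exI[of _ "{}"] exI[of _ "{X}"] exI[of _ "{X, Y}"])
    then have "\<forall>i\<le>2. c i \<in> ?L" by (simp add: c_def)
    moreover have "\<forall>i<2. c i \<subset> c (Suc i)"
      using X Y by (auto simp: c_def less_2_cases_iff)
    moreover have "c 2 = ?U" by (simp add: c_def)
    ultimately show ?thesis by blast
  qed
  moreover have "finite ?N" using upper by (intro finite_subset[of ?N "{..2}"]) auto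
  ultimately have "Max ?N = 2" using upper by (intro Max_eqI) auto
  then have "height ?L ?U = 2" unfolding height_def .
  moreover have "X \<noteq> Y" using Y by auto
  ultimately show ?thesis
    using X Y by (simp add: modular_family_def)
qed

lemma hadd_supp_subset:
  assumes "\<And>f. Z f \<in> X f \<boxplus> (a::'f::hyperfield) * Y f"
  shows "supp Z \<subseteq> supp X \<union> supp Y"
proof
  fix f assume "f \<in> supp Z"
  then show "f \<in> supp X \<union> supp Y"
    using assms[of f] by (auto simp: supp_def)
qed

locale weak_circuits =
  fixes E :: "'e set" and C :: "('e \<Rightarrow> 'f::hyperfield) set"
  assumes weak: "weak_matroid E C"
begin

lemma finite_ground: "finite E" and C_sub: "C \<subseteq> funspace E"
  using weak by (simp_all add: weak_matroid_def)

lemma scale_mem: "X \<in> C \<Longrightarrow> a \<noteq> 0 \<Longrightarrow> (\<lambda>e. a * X e) \<in> C"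
  using weak by (simp add: weak_matroid_def C1_def)

lemma supp_subset_imp_scale:
  assumes "X \<in> C" "Y \<in> C" "supp X \<subseteq> supp Y"
  obtains a where "a \<noteq> 0" "X = (\<lambda>e. a * Y e)"
  using assms weak unfolding weak_matroid_def C2_def by blast

lemma supp_clutter: "X \<in> C \<Longrightarrow> Y \<in> C \<Longrightarrow> supp X \<subseteq> supp Y \<Longrightarrow> supp X = supp Y"
  by (erule supp_subset_imp_scale[of X Y]) (auto simp: supp_scale)

lemma supp_nonempty: "X \<in> C \<Longrightarrow> supp X \<noteq> {}"
  using weak by (auto simp: weak_matroid_def C0_def supp_eq_empty)

lemma modular_elim:
  assumes X: "X \<in> C" and Y: "Y \<in> C" and ne: "supp X \<noteq> supp Y" and e: "e \<in> supp X" "e \<in> supp Y"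
    and no: "\<And>A B. A \<in> C \<Longrightarrow> B \<in> C \<Longrightarrow> supp A \<noteq> supp B \<Longrightarrow>
      \<not> supp A \<union> supp B \<subset> supp X \<union> supp Y"
  obtains a Z where "a \<noteq> 0" "Z \<in> C" "X e = - (a * Y e)" "Z e = 0" "\<And>f. Z f \<in> X f \<boxplus> a * Y f"
proof -
  obtain a where a: "a * Y e = - X e" using ex_mult_eq e by (metis (mono_tags) mem_Collect_eq supp_def)
  then have a0: "a \<noteq> 0" using e by (auto simp: supp_def)
  let ?Y = "\<lambda>e. a * Y e"
  have Y': "?Y \<in> C" "supp ?Y = supp Y" using scale_mem Y a0 by (auto simp: supp_scale)
  have "modular_family C 2 {X, ?Y}"
    by (rule modular_pairI) (use X Y' supp_nonempty ne no supp_clutter[OF Y X] Y in auto)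
  moreover have "X e = - ?Y e" "X e \<noteq> 0" using a e by (auto simp: supp_def)
  ultimately have "\<exists>Z\<in>C. Z e = 0 \<and> (\<forall>f. Z f \<in> X f \<boxplus> ?Y f)"
    using weak X Y'(1) unfolding weak_matroid_def C3_weak_def by blast
  then obtain Z where "Z \<in> C" "Z e = 0" "\<forall>f. Z f \<in> X f \<boxplus> ?Y f" by blast
  then show ?thesis using that a0 a by simp
qed

text \<open>A pair that is not modular contains two circuits with a smaller union, so a pair with
  minimal union is modular.\<close>

lemma supp_elim:
  assumes "X \<in> C" "Y \<in> C" "supp X \<noteq> supp Y" "e \<in> supp X" "e \<in> supp Y"
  shows "\<exists>Z\<in>C. supp Z \<subseteq> supp X \<union> supp Y - {e}"
  using assms
proof (induction "card (supp X \<union> supp Y)" arbitrary: X Y rule: less_induct)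
  case less
  show ?case
  proof (cases "\<exists>A\<in>C. \<exists>B\<in>C. supp A \<noteq> supp B \<and> supp A \<union> supp B \<subset> supp X \<union> supp Y")
    case True
    then obtain A B where AB: "A \<in> C" "B \<in> C" "supp A \<noteq> supp B"
      and sub: "supp A \<union> supp B \<subset> supp X \<union> supp Y" by blast
    have "supp X \<union> supp Y \<subseteq> E" using C_sub less.prems by (auto simp: funspace_def)
    then have "finite (supp X \<union> supp Y)" using finite_ground finite_subset by blast
    with sub have less': "card (supp A \<union> supp B) < card (supp X \<union> supp Y)"
      by (simp add: psubset_card_mono)
    show ?thesis
    proof (cases "e \<in> supp A \<and> e \<in> supp B")
      case True
      then obtain Z where "Z \<in> C" "supp Z \<subseteq> supp A \<union> supp B - {e}"
        using less.hyps[OF less' AB] by blast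
      then show ?thesis using sub by blast
    next
      case False
      then show ?thesis using AB sub by blast
    qed
  next
    case False
    then obtain a Z where Z: "Z \<in> C" "Z e = 0" "\<And>f. Z f \<in> X f \<boxplus> a * Y f"
      using modular_elim[OF less.prems] by metis
    then have "supp Z \<subseteq> supp X \<union> supp Y - {e}"
      using hadd_supp_subset[of Z X a Y] by (auto simp: supp_def)
    then show ?thesis using Z by blast
  qed
qed

sublocale circuit_system E "supp ` C"
proof
  show "finite E" by (rule finite_ground)
  show "A \<subseteq> E" if "A \<in> supp ` C" for A using that C_sub by (auto simp: funspace_def)
  show "A \<noteq> {}" if "A \<in> supp ` C" for A using that supp_nonempty by auto
  show "A = B" if "A \<in> supp ` C" "B \<in> supp ` C" "A \<subseteq> B" for A B
    using that supp_clutter by auto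
  show "\<exists>Z\<in>supp ` C. Z \<subseteq> A \<union> B - {e}"
    if "A \<in> supp ` C" "B \<in> supp ` C" "A \<noteq> B" "e \<in> A \<inter> B" for A B e
    using that supp_elim by auto
qed

lemma supp_strong_elim:
  assumes "X \<in> C" "Y \<in> C" "e \<in> supp X" "e \<in> supp Y" "f \<in> supp X" "f \<notin> supp Y"
  obtains Z where "Z \<in> C" "f \<in> supp Z" "supp Z \<subseteq> supp X \<union> supp Y - {e}"
  using strong_elim[OF imageI[OF assms(1)] imageI[OF assms(2)] assms(3-)] that by blast

text \<open>Inside \<open>insert f (insert g I)\<close> the union of two distinct circuits contains
  every circuit, so no pair has a smaller union and the weak elimination axiom applies.\<close>

lemma nullity_two_elim:
  assumes I: "indep I" and XY: "X \<in> C" "Y \<in> C" "supp X \<noteq> supp Y"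
    and sub: "supp X \<subseteq> insert f (insert g I)" "supp Y \<subseteq> insert f (insert g I)"
    and e: "e \<in> supp X" "e \<in> supp Y"
  obtains a Z where "a \<noteq> 0" "Z \<in> C" "X e = - (a * Y e)" "Z e = 0" "\<And>f. Z f \<in> X f \<boxplus> a * Y f"
    "supp Z \<subseteq> supp X \<union> supp Y - {e}"
proof -
  have "\<not> supp A \<union> supp B \<subset> supp X \<union> supp Y" if "A \<in> C" "B \<in> C" "supp A \<noteq> supp B" for A B
  proof
    assume less: "supp A \<union> supp B \<subset> supp X \<union> supp Y"
    then have "supp A \<subseteq> insert f (insert g I)" "supp B \<subseteq> insert f (insert g I)" using sub by auto
    then have "supp W \<subseteq> supp A \<union> supp B" if "W \<in> C" "supp W \<subseteq> insert f (insert g I)" for W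
      using circuit_subset_Un[OF I, of "supp A" "supp B" "supp W"] \<open>A \<in> C\<close> \<open>B \<in> C\<close> \<open>supp A \<noteq> supp B\<close> that
      by blast
    then show False using less sub XY by blast
  qed
  then obtain a Z where Z: "a \<noteq> 0" "Z \<in> C" "X e = - (a * Y e)" "Z e = 0" "\<And>f. Z f \<in> X f \<boxplus> a * Y f"
    using modular_elim[OF XY e] by metis
  moreover have "supp Z \<subseteq> supp X \<union> supp Y - {e}"
    using hadd_supp_subset[of Z X a Y] Z by (auto simp: supp_def)
  ultimately show ?thesis using that by blast
qed

lemma indep_proper:
  assumes "X \<in> C" "I \<subset> supp X"
  shows "indep I"
  unfolding indep_def using assms clutter by blast

end

text \<open>\<open>closed\<close> makes \<open>H\<close> a flat, and \<open>connected\<close> says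
  that \<open>H\<close> and \<open>e\<close> together span \<open>E\<close>. So \<open>H\<close> is
  a hyperplane avoiding \<open>e\<close>, and \<open>E - H\<close> is a cocircuit.\<close>

locale weak_hyperplane = weak_circuits +
  fixes H :: "'a set" and e :: 'a
  assumes H_sub: "H \<subseteq> E" and e: "e \<in> E" "e \<notin> H"
    and closed: "X \<in> C \<Longrightarrow> supp X - H \<noteq> {f}"
    and connected: "f \<in> E - H - {e} \<Longrightarrow> \<exists>X\<in>C. supp X - H = {e, f}"
begin

lemma closed': "A \<in> supp ` C \<Longrightarrow> A - H \<noteq> {f}"
  using closed by blast

lemma mem_of_Diff_eq: "A - H = S \<Longrightarrow> x \<notin> H \<Longrightarrow> x \<in> A \<longleftrightarrow> x \<in> S"
  by blast

lemma into_basis: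
  assumes "spanning_indep H B" "X \<in> C" "supp X - H = {f, g}"
  obtains X' where "X' \<in> C" "supp X' - H = {f, g}" "supp X' \<subseteq> insert f (insert g B)"
proof -
  from circuit_pair_basis[OF closed' assms(1) imageI[OF assms(2)] assms(3)]
  obtain A where "A \<in> supp ` C" "A - H = {f, g}" "A \<subseteq> insert f (insert g B)" by blast
  then show ?thesis using that by blast
qed

lemma indep_insert: "spanning_indep H B \<Longrightarrow> f \<notin> H \<Longrightarrow> indep (insert f B)"
  using indep_insert_closed[OF closed'] by blast

text \<open>Over a single basis the circuit is unique and (C2) applies. Otherwise \<open>B\<close>
  moves towards \<open>B'\<close> by one exchange, which leaves the old and the new circuit in a set
  of nullity two. Eliminating \<open>f\<close> gives a circuit that leaves the flat \<open>H\<close>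
  at most in \<open>g\<close>, hence not at all, so the scalar that cancels at \<open>f\<close> also
  cancels at \<open>g\<close>.\<close>

lemma proportional_basis:
  assumes "f \<noteq> g" "spanning_indep H B" "spanning_indep H B'" and "X \<in> C" "X' \<in> C"
    and "supp X - H = {f, g}" "supp X' - H = {f, g}"
    and "supp X \<subseteq> insert f (insert g B)" "supp X' \<subseteq> insert f (insert g B')"
  shows "X f * X' g = X g * X' f"
  using assms
proof (induction "card (B' - B)" arbitrary: B X rule: less_induct)
  case less
  have fg: "f \<notin> H" "g \<notin> H" "f \<in> supp X" "g \<in> supp X" "f \<in> supp X'" "g \<in> supp X'"
    using less.prems by blast+
  show ?case
  proof (cases "B' \<subseteq> B")
    case True
    then have sub: "supp X \<subseteq> insert g (insert f B)" "supp X' \<subseteq> insert g (insert f B)"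
      using less.prems(8,9) by blast+
    have "supp X = supp X'"
      using circuit_unique[OF indep_insert[OF less.prems(2) fg(1)] _ _ sub] less.prems by blast
    then obtain a where "X = (\<lambda>e. a * X' e)"
      using supp_subset_imp_scale[of X X'] less.prems by auto
    then show ?thesis by (simp add: ac_simps)
  next
    case False
    then obtain c where c: "c \<in> B' - B" by blast
    obtain b where b: "b \<in> B - B'" "spanning_indep H (insert c (B - {b}))" (is "spanning_indep H ?B")
      using spanning_indep_exchange[OF less.prems(2,3) c] by blast
    obtain X'' where X'': "X'' \<in> C" "supp X'' - H = {f, g}" "supp X'' \<subseteq> insert f (insert g ?B)"
      using into_basis[OF b(2) less.prems(4,6)] by blast
    have fg'': "f \<in> supp X''" "g \<in> supp X''" using X'' by auto
    have "finite (B' - B)"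
      using less.prems(3) H_sub finite_ground unfolding spanning_indep_def
      by (meson finite_Diff finite_subset)
    moreover have "B' - ?B \<subset> B' - B" using b c by blast
    ultimately have "card (B' - ?B) < card (B' - B)" by (simp add: psubset_card_mono)
    then have IH: "X'' f * X' g = X'' g * X' f"
      using less.hyps[of ?B X''] less.prems b X'' by blast
    have "X f * X'' g = X g * X'' f"
    proof (cases "supp X = supp X''")
      case True
      then obtain a where "X = (\<lambda>e. a * X'' e)"
        using supp_subset_imp_scale[of X X''] less.prems X'' by auto
      then show ?thesis by (simp add: ac_simps)
    next
      case ne: False
      have sub: "supp X \<subseteq> insert c (insert g (insert f B))" "supp X'' \<subseteq> insert c (insert g (insert f B))"
        using less.prems X'' by auto
      obtain a Z where Z: "a \<noteq> 0" "Z \<in> C" "X f = - (a * X'' f)" "\<And>x. Z x \<in> X x \<boxplus> a * X'' x"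
        "supp Z \<subseteq> supp X \<union> supp X'' - {f}"
        using nullity_two_elim[OF indep_insert[OF less.prems(2) fg(1)] less.prems(4) X''(1) ne sub fg(3) fg''(1)]
        by metis
      have "supp Z - H \<subseteq> {g}" using Z(5) less.prems(6) X''(2) by blast
      then have "g \<notin> supp Z" using closed[OF Z(2), of g] fg by blast
      then have "a * X'' g = - X g" using Z(4)[of g] by (simp add: supp_def zero_in_hadd_iff)
      then have "a * (X f * X'' g) = - (X f * X g)"
        by (metis mult.left_commute mult_hneg_right)
      moreover have "a * X'' f = - X f" using Z(3) by simp
      then have "a * (X g * X'' f) = - (X f * X g)"
        by (metis mult.commute mult.left_commute mult_hneg_right)
      ultimately show ?thesis using hmult_cancel[OF Z(1)] by metis
    qed
    then have "X'' g * (X f * X' g) = X'' g * (X g * X' f)"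
      using IH by (metis mult.assoc mult.commute)
    then show ?thesis using hmult_cancel[of "X'' g"] fg'' by (simp add: supp_def)
  qed
qed

lemma spanning_indep_of_circuit:
  assumes "X \<in> C" "supp X - H \<noteq> {}"
  obtains B where "spanning_indep H B" "supp X \<inter> H \<subseteq> B"
proof -
  have "indep (supp X \<inter> H)" by (rule indep_proper[OF assms(1)]) (use assms(2) in blast)
  then show ?thesis using spanning_indep_extend[of "supp X \<inter> H" H] H_sub that by blast
qed

lemma proportional:
  assumes "f \<noteq> g" "X \<in> C" "X' \<in> C" and X: "supp X - H = {f, g}" and X': "supp X' - H = {f, g}"
  shows "X f * X' g = X g * X' f"
proof -
  obtain B where B: "spanning_indep H B" "supp X \<inter> H \<subseteq> B"
    using spanning_indep_of_circuit[of X] assms by blast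
  obtain B' where B': "spanning_indep H B'" "supp X' \<inter> H \<subseteq> B'"
    using spanning_indep_of_circuit[of X'] assms by blast
  have "supp X \<subseteq> insert f (insert g B)" using B X by blast
  moreover have "supp X' \<subseteq> insert f (insert g B')" using B' X' by blast
  ultimately show ?thesis using proportional_basis[OF assms(1) B(1) B'(1)] assms by blast
qed

text \<open>Two circuits that leave \<open>H\<close> in \<open>{e, f}\<close> and
  \<open>{e, g}\<close> lose \<open>e\<close> by strong elimination and keep \<open>f\<close>;
  flatness then keeps \<open>g\<close>.\<close>

lemma pair_exists:
  assumes "f \<in> E - H" "g \<in> E - H" "f \<noteq> g"
  shows "\<exists>X\<in>C. supp X - H = {f, g}"
proof -
  consider "f = e" | "g = e" | "f \<noteq> e" "g \<noteq> e" by blast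
  then show ?thesis
  proof cases
    case 1
    then show ?thesis using connected[of g] assms by simp
  next
    case 2
    then show ?thesis using connected[of f] assms by (simp add: insert_commute)
  next
    case 3
    then obtain X X' where X: "X \<in> C" "supp X - H = {e, f}" and X': "X' \<in> C" "supp X' - H = {e, g}"
      using connected[of f] connected[of g] assms by auto
    have "e \<in> supp X" "e \<in> supp X'" "f \<in> supp X" "f \<notin> supp X'"
      using X X' assms 3 by blast+
    then obtain Z where Z: "Z \<in> C" "f \<in> supp Z" "supp Z \<subseteq> supp X \<union> supp X' - {e}"
      using supp_strong_elim[OF X(1) X'(1)] by blast
    have "supp Z - H \<subseteq> {f, g}" using Z X X' by blast
    then have "supp Z - H = {f, g}" using closed[OF Z(1), of f] Z assms by blast
    then show ?thesis using Z by blast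
  qed
qed

text \<open>With the value 1 at \<open>e\<close>, orthogonality to one circuit through
  \<open>e\<close> and \<open>f\<close> forces the value at \<open>f\<close>. That another circuit
  would force the same value is the content of \<open>proportional\<close>.\<close>

lemma cocircuit_function:
  obtains Y where "supp Y = E - H" "Y e = 1"
    "\<And>f. f \<in> E - H - {e} \<Longrightarrow> \<exists>X\<in>C. supp X - H = {e, f} \<and> X f * Y f = - X e"
proof -
  have "\<exists>c. \<exists>X\<in>C. supp X - H = {e, f} \<and> X f * c = - X e \<and> c \<noteq> 0" if f: "f \<in> E - H - {e}" for f
  proof -
    obtain X where X: "X \<in> C" "supp X - H = {e, f}" using connected f by blast
    then have "X e \<noteq> 0" "X f \<noteq> 0" by (auto simp: supp_def)
    moreover from this obtain c where c: "c * X f = - X e" using ex_mult_eq by blast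
    ultimately have "c \<noteq> 0" by auto
    then show ?thesis using X c by (metis mult.commute)
  qed
  then obtain c where c: "\<And>f. f \<in> E - H - {e} \<Longrightarrow>
      (\<exists>X\<in>C. supp X - H = {e, f} \<and> X f * c f = - X e) \<and> c f \<noteq> 0"
    by metis
  let ?Y = "\<lambda>f. if f = e then 1 else if f \<in> E - H then c f else 0"
  have "supp ?Y = E - H" using c e by (auto simp: supp_def)
  moreover have "\<exists>X\<in>C. supp X - H = {e, f} \<and> X f * ?Y f = - X e" if "f \<in> E - H - {e}" for f
    using c[OF that] that by simp
  ultimately show ?thesis using that[of ?Y] by simp
qed

context
  fixes Y :: "'a \<Rightarrow> 'b"
  assumes Y: "supp Y = E - H" "Y e = 1"
    and Y_eq: "f \<in> E - H - {e} \<Longrightarrow> \<exists>X\<in>C. supp X - H = {e, f} \<and> X f * Y f = - X e"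
begin

lemma orth_pair_root:
  assumes X: "X \<in> C" "supp X - H = {e, f}" and f: "f \<in> E - H - {e}"
  shows "X f * Y f = - X e"
proof -
  obtain X' where X': "X' \<in> C" "supp X' - H = {e, f}" "X' f * Y f = - X' e" using Y_eq f by blast
  have "X e * X' f = X f * X' e" using proportional[of e f X X'] X X' f by blast
  then have "X' f * (X f * Y f) = X' f * - X e"
    using X'(3) by (metis mult.commute mult.left_commute mult_hneg_right)
  moreover have "X' f \<noteq> 0" using X' by (auto simp: supp_def)
  ultimately show ?thesis using hmult_cancel by blast
qed

text \<open>For \<open>f\<close> and \<open>g\<close> different from \<open>e\<close>, circuits
  \<open>F\<close> and \<open>G\<close> leaving \<open>H\<close> in \<open>{e, f}\<close> and
  \<open>{e, g}\<close> are taken over one basis, so that they form a modular pair. Eliminating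
  \<open>e\<close> gives a circuit on \<open>{f, g}\<close> with the values \<open>F f\<close> and
  \<open>a * G g\<close>, for which the claim is a computation; \<open>proportional\<close> carries
  it to \<open>X\<close>.\<close>

lemma orth_pair:
  assumes X: "X \<in> C" "supp X - H = {f, g}" and "f \<noteq> g"
  shows "X f * Y f = - (X g * Y g)"
proof -
  have fg: "f \<in> E - H" "g \<in> E - H" using X C_sub by (auto simp: funspace_def)
  consider "f = e" | "g = e" | "f \<noteq> e" "g \<noteq> e" by blast
  then show ?thesis
  proof cases
    case 1
    then show ?thesis using orth_pair_root[of X g] X fg assms(3) Y(2) by simp
  next
    case 2
    then show ?thesis using orth_pair_root[of X f] X fg assms(3) Y(2) by (simp add: insert_commute)
  next
    case 3
    obtain B where B: "spanning_indep H B"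
      using spanning_indep_of_circuit[of X] X by blast
    obtain F where "F \<in> C" "supp F - H = {e, f}" using pair_exists[of e f] e fg 3 by blast
    then obtain F where F: "F \<in> C" "supp F - H = {e, f}" "supp F \<subseteq> insert e (insert f B)"
      using into_basis[OF B] by blast
    obtain G where "G \<in> C" "supp G - H = {e, g}" using pair_exists[of e g] e fg 3 by blast
    then obtain G where G: "G \<in> C" "supp G - H = {e, g}" "supp G \<subseteq> insert e (insert g B)"
      using into_basis[OF B] by blast
    have "f \<in> supp F" "f \<notin> supp G" "g \<in> supp G" "g \<notin> supp F"
      using F G fg 3 assms(3) by blast+
    moreover from this have "supp F \<noteq> supp G" by blast
    moreover have "supp F \<subseteq> insert f (insert g (insert e B))" "supp G \<subseteq> insert f (insert g (insert e B))"
      using F G by auto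
    moreover have "e \<in> supp F" "e \<in> supp G" using F G by auto
    ultimately obtain a Z where Z: "a \<noteq> 0" "Z \<in> C" "F e = - (a * G e)" "\<And>x. Z x \<in> F x \<boxplus> a * G x"
        "supp Z \<subseteq> supp F \<union> supp G - {e}"
      using nullity_two_elim[OF indep_insert[OF B e(2)] F(1) G(1), of f g e] by metis
    have Zfg: "Z f = F f" "Z g = a * G g"
      using Z(4)[of f] Z(4)[of g] \<open>f \<notin> supp G\<close> \<open>g \<notin> supp F\<close> by (simp_all add: supp_def)
    have "f \<in> supp Z" using Zfg \<open>f \<in> supp F\<close> by (simp add: supp_def)
    moreover have "supp Z - H \<subseteq> {f, g}" using Z(5) F(2) G(2) by blast
    ultimately have "supp Z - H = {f, g}" using closed[OF Z(2), of f] fg by blast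
    then have XZ: "X f * Z g = X g * Z f" using proportional[of f g X Z] X Z(2) assms(3) by blast
    have "F f * Y f = - F e" "G g * Y g = - G e"
      using orth_pair_root F G fg 3 by blast+
    then have "Z f * Y f = a * G e" "Z g * Y g = - (a * G e)"
      using Z(3) Zfg by (simp_all add: mult.assoc mult_hneg_right)
    then have "Z f * Y f = - (Z g * Y g)" by simp
    then have "Z f * (X f * Y f) = - (X f * (Z g * Y g))"
      by (metis mult.left_commute mult_hneg_right)
    also have "\<dots> = - (Z f * (X g * Y g))"
      using XZ by (metis mult.assoc mult.commute)
    finally have "Z f * (X f * Y f) = Z f * - (X g * Y g)" by (simp add: mult_hneg_right)
    moreover have "Z f \<noteq> 0" using \<open>f \<in> supp Z\<close> by (simp add: supp_def)
    ultimately show ?thesis using hmult_cancel by blast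
  qed
qed

text \<open>\<open>X\<close> is recovered, up to a scalar, by one elimination from circuits
  \<open>F\<close> on \<open>{p, q}\<close> and \<open>G\<close> on \<open>{p, r}\<close> over the
  same basis. Only one factor is copied at \<open>q\<close> and at \<open>r\<close>, while at
  \<open>p\<close> the value lies in a hypersum; multiplied by \<open>Y p\<close>, this membership
  becomes the orthogonality relation. A fourth element outside \<open>H\<close> would raise the
  nullity to three.\<close>

lemma orth_triple:
  assumes X: "X \<in> C" "supp X - H = {p, q, r}" and distinct: "p \<noteq> q" "p \<noteq> r" "q \<noteq> r"
  shows "orthogonal E X Y"
proof -
  have pqr: "p \<in> E - H" "q \<in> E - H" "r \<in> E - H" using X C_sub by (auto simp: funspace_def)
  obtain B where B: "spanning_indep H B" "supp X \<inter> H \<subseteq> B"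
    using spanning_indep_of_circuit[of X] X by blast
  then have BH: "B \<subseteq> H" unfolding spanning_indep_def by blast
  obtain F where "F \<in> C" "supp F - H = {p, q}" using pair_exists[of p q] pqr distinct by blast
  then obtain F where F: "F \<in> C" "supp F - H = {p, q}" "supp F \<subseteq> insert p (insert q B)"
    using into_basis[OF B(1)] by blast
  obtain G where "G \<in> C" "supp G - H = {p, r}" using pair_exists[of p r] pqr distinct by blast
  then obtain G where G: "G \<in> C" "supp G - H = {p, r}" "supp G \<subseteq> insert p (insert r B)"
    using into_basis[OF B(1)] by blast
  let ?W = "insert q (insert r (insert p B))"
  have I: "indep (insert p B)" using indep_insert B pqr by blast
  have sub: "supp F \<subseteq> ?W" "supp G \<subseteq> ?W" "supp X \<subseteq> ?W" using F G X B by auto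
  have mems: "q \<in> supp F" "q \<notin> supp G" "r \<in> supp G" "r \<notin> supp F" "q \<in> supp X" "r \<in> supp X"
    "p \<in> supp F" "p \<in> supp G" "p \<in> supp X"
    using pqr distinct mem_of_Diff_eq[OF F(2)] mem_of_Diff_eq[OF G(2)] mem_of_Diff_eq[OF X(2)]
    by auto
  then have ne: "supp F \<noteq> supp G" "supp F \<noteq> supp X" "supp G \<noteq> supp X" by blast+
  then obtain h where h: "h \<in> supp F" "h \<notin> supp X"
    using supp_clutter[OF F(1) X(1)] by blast
  have "supp F \<subseteq> supp X \<union> supp G"
    using circuit_subset_Un[OF I, of "supp X" "supp G" "supp F"] sub ne X F G by blast
  then have "h \<in> supp G" using h by blast
  then obtain a Z where Z: "a \<noteq> 0" "Z \<in> C" "\<And>x. Z x \<in> F x \<boxplus> a * G x"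
      "supp Z \<subseteq> supp F \<union> supp G - {h}"
    using nullity_two_elim[OF I F(1) G(1) ne(1) sub(1,2) h(1)] by metis
  \<comment> \<open>Two distinct circuits in a set of nullity two cover \<open>F\<close>, but
    neither \<open>Z\<close> nor \<open>X\<close> contains \<open>h\<close>.\<close>
  have "supp Z = supp X"
  proof (rule ccontr)
    assume "supp Z \<noteq> supp X"
    moreover have "supp Z \<subseteq> ?W" using Z sub by blast
    ultimately have "supp F \<subseteq> supp Z \<union> supp X"
      using circuit_subset_Un[OF I, of "supp Z" "supp X" "supp F"] sub Z X F by blast
    then show False using h Z by blast
  qed
  then obtain b where b: "X = (\<lambda>e. b * Z e)"
    using supp_subset_imp_scale[OF X(1) Z(2) equalityD2] by blast
  have Zqr: "Z q = F q" "Z r = a * G r"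
    using Z(3)[of q] Z(3)[of r] mems by (simp_all add: supp_def)
  have "p \<noteq> q" "p \<noteq> r" using distinct by auto
  then have FG: "F p * Y p = - (F q * Y q)" "G p * Y p = - (G r * Y r)"
    using orth_pair F G by blast+
  have "Y p * Z p \<in> (*) (Y p) ` (F p \<boxplus> a * G p)" using Z(3) by blast
  then have "Y p * Z p \<in> Y p * F p \<boxplus> Y p * (a * G p)" by (simp only: hadd_distrib)
  then have "Z p * Y p \<in> - (Z q * Y q) \<boxplus> - (Z r * Y r)"
    using FG Zqr by (simp add: ac_simps mult_hneg_right)
  then have "- (Z p * Y p) \<in> uminus ` (- (Z q * Y q) \<boxplus> - (Z r * Y r))" by blast
  then have "- (Z p * Y p) \<in> Z q * Y q \<boxplus> Z r * Y r" by (simp add: hneg_hadd_distrib)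
  then have "orthogonal {p, q, r} Z Y"
    using distinct by (simp add: orthogonal_def zero_in_hadd_set_singleton)
  moreover have "supp Z \<inter> supp Y \<subseteq> {p, q, r}" using \<open>supp Z = supp X\<close> X Y by blast
  ultimately have "orthogonal E Z Y"
    using orthogonal_restrict[of E "{p, q, r}" Z Y] finite_ground pqr by simp
  then show ?thesis unfolding b by (rule orthogonal_scale)
qed

lemma orth_card_le_3:
  assumes X: "X \<in> C" and card: "card (supp X \<inter> supp Y) \<le> 3"
  shows "orthogonal E X Y"
proof -
  have XE: "supp X \<subseteq> E" using X C_sub by (auto simp: funspace_def)
  then have eq: "supp X \<inter> supp Y = supp X - H" using Y(1) by blast
  have "finite (supp X - H)" using XE finite_ground finite_subset by blast
  moreover have "card (supp X - H) = 0 \<or> card (supp X - H) = 1 \<or> card (supp X - H) = 2 \<or> card (supp X - H) = 3"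
    using card eq by auto
  ultimately consider "supp X - H = {}" | f where "supp X - H = {f}"
    | f g where "supp X - H = {f, g}" "f \<noteq> g"
    | p q r where "supp X - H = {p, q, r}" "p \<noteq> q" "p \<noteq> r" "q \<noteq> r"
    by (auto simp: card_1_singleton_iff card_2_iff card_3_iff)
  then show ?thesis
  proof cases
    case 1
    then have "orthogonal E X Y \<longleftrightarrow> orthogonal {} X Y"
      using orthogonal_restrict[of E "{}" X Y] eq finite_ground by simp
    then show ?thesis by (simp add: orthogonal_def)
  next
    case 2
    then show ?thesis using closed X by blast
  next
    case 3
    then show ?thesis
      using orthogonal_pair[of E f g X Y] orth_pair[OF X 3] eq finite_ground XE by blast
  next
    case 4
    then show ?thesis using orth_triple X by blast
  qed
qed

end

end

section \<open>The dual side of a weak matroid\<close>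

context weak_circuits
begin

text \<open>A condition instead of the list of functions built from hyperplanes. It also admits zero
  and non-minimal supports; the cocircuit functions are its members of minimal support.\<close>

definition weak_dual :: "('e \<Rightarrow> 'f) set"
  where "weak_dual = {Y \<in> funspace E. \<forall>X\<in>C. card (supp X \<inter> supp Y) \<le> 3 \<longrightarrow> orthogonal E X Y}"

lemma weak_dual_neq_singleton:
  assumes "X \<in> C" "Y \<in> weak_dual"
  shows "supp X \<inter> supp Y \<noteq> {e}"
proof
  assume "supp X \<inter> supp Y = {e}"
  then have "orthogonal E X Y" using assms by (simp add: weak_dual_def)
  then show False
    using orthogonal_neq_singleton[OF finite_ground _ \<open>orthogonal E X Y\<close>, of e] C_sub assms
      \<open>supp X \<inter> supp Y = {e}\<close> by blast
qed

lemma painting_weak_dual: "painting E C weak_dual"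
  unfolding painting_def
proof (intro ballI allI impI)
  fix e R assume e: "e \<in> E" "e \<notin> R"
  show "(\<exists>X\<in>C. e \<in> supp X \<and> supp X \<subseteq> insert e R) \<or>
    (\<exists>Y\<in>weak_dual. e \<in> supp Y \<and> supp Y \<inter> R = {})"
  proof (cases "\<exists>X\<in>C. e \<in> supp X \<and> supp X \<subseteq> insert e R")
    case False
    then have "\<And>A. A \<in> supp ` C \<Longrightarrow> e \<in> A \<Longrightarrow> \<not> A \<subseteq> insert e R" by blast
    from hyperplane_exists[OF e this] obtain H where H: "H \<subseteq> E" "R \<inter> E \<subseteq> H" "e \<notin> H"
      and closed: "\<And>A f. A \<in> supp ` C \<Longrightarrow> A - H \<noteq> {f}"
      and connected: "\<And>f. f \<in> E - H - {e} \<Longrightarrow> \<exists>A\<in>supp ` C. A - H = {e, f}"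
      by blast
    interpret weak_hyperplane E C H e
      using H e closed connected by unfold_locales auto
    obtain Y where Y: "supp Y = E - H" "Y e = 1"
      "\<And>f. f \<in> E - H - {e} \<Longrightarrow> \<exists>X\<in>C. supp X - H = {e, f} \<and> X f * Y f = - X e"
      using cocircuit_function by blast
    then have "Y \<in> weak_dual"
      using orth_card_le_3[OF Y] by (auto simp: weak_dual_def funspace_def)
    moreover have "e \<in> supp Y" "supp Y \<inter> R = {}" using Y(1) H e by auto
    ultimately show ?thesis by blast
  qed blast
qed

end

section \<open>Orthogonal dual pairs are strong matroids\<close>

text \<open>Since \<open>height\<close> is a \<open>Max\<close>, the point is that chain lengths are
  bounded: member number \<open>i\<close> of a chain has at least \<open>i\<close> elements.\<close>

lemma height_ge:
  assumes "finite A" "\<And>i. i \<le> n \<Longrightarrow> c i \<in> L" "\<And>i. i < n \<Longrightarrow> c i \<subset> c (Suc i)" "c n = A"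
  shows "n \<le> height L A"
proof -
  let ?N = "{n. \<exists>c::nat \<Rightarrow> _. (\<forall>i\<le>n. c i \<in> L) \<and> (\<forall>i<n. c i \<subset> c (Suc i)) \<and> c n = A}"
  have "m \<le> card A" if "m \<in> ?N" for m
  proof -
    from that obtain b where b: "\<And>i. i < m \<Longrightarrow> b i \<subset> b (Suc i)" "b m = A" by blast
    have sub: "b i \<subseteq> A" if "i \<le> m" for i
      using that by (induction rule: inc_induct) (use b in blast)+
    have "i \<le> card (b i)" if "i \<le> m" for i
      using that
    proof (induction i)
      case (Suc i)
      have "finite (b (Suc i))" using sub Suc.prems assms(1) finite_subset by blast
      then have "card (b i) < card (b (Suc i))" using b(1)[of i] Suc.prems by (simp add: psubset_card_mono)
      then show ?case using Suc by simp
    qed simp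
    then show ?thesis using b(2) by blast
  qed
  then have "finite ?N" by (intro finite_subset[of ?N "{..card A}"]) auto
  moreover have "n \<in> ?N" using assms by blast
  ultimately show ?thesis unfolding height_def by (rule Max_ge)
qed

text \<open>Two functions orthogonal to a third on the same two elements have equal ratios there, so
  a factor found at one element holds at the other.\<close>

lemma orthogonal_transfer_scale:
  fixes u v u' v' s t :: "'f::hyperfield"
  assumes "u * s = - (v * t)" "u' * s = - (v' * t)" "u = a * u'" "t \<noteq> 0"
  shows "v = a * v'"
proof -
  have "t * v = - (u * s)" using assms(1) by (simp add: mult.commute)
  also have "\<dots> = a * - (u' * s)" using assms(3) by (simp add: mult_hneg_right mult.assoc)
  also have "\<dots> = t * (a * v')" using assms(2) by (simp add: ac_simps)
  finally show ?thesis using hmult_cancel[OF assms(4)] by blast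
qed

text \<open>Only \<open>C\<close> is a clutter closed under scalars, so that for a minor
  \<open>D\<close> can be the plain family of restrictions.\<close>

locale orthogonal_dual_pair =
  fixes E :: "'e set" and C D :: "('e \<Rightarrow> 'f::hyperfield) set"
  assumes finite_ground: "finite E"
    and C_sub: "C \<subseteq> funspace E" and D_sub: "D \<subseteq> funspace E"
    and painting: "painting E C D"
    and orth: "X \<in> C \<Longrightarrow> Y \<in> D \<Longrightarrow> orthogonal E X Y"
    and zero_notin: "(\<lambda>_. 0) \<notin> C"
    and supp_clutter: "X \<in> C \<Longrightarrow> X' \<in> C \<Longrightarrow> supp X \<subseteq> supp X' \<Longrightarrow> supp X = supp X'"
    and scale_mem: "X \<in> C \<Longrightarrow> a \<noteq> 0 \<Longrightarrow> (\<lambda>e. a * X e) \<in> C"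
begin

lemma supp_sub: "X \<in> C \<Longrightarrow> supp X \<subseteq> E"
  using C_sub by (auto simp: funspace_def)

lemma supp_nonempty: "X \<in> C \<Longrightarrow> supp X \<noteq> {}"
  using zero_notin by (auto simp: supp_eq_empty)

lemma neq_singleton: "X \<in> C \<Longrightarrow> Y \<in> D \<Longrightarrow> supp X \<inter> supp Y \<noteq> {e}"
  using orthogonal_neq_singleton[OF finite_ground _ orth] C_sub by blast

text \<open>Painting \<open>e\<close> against \<open>supp X - {e, f}\<close> cannot give a circuit,
  which would be smaller than \<open>X\<close>; the dual element it gives cannot meet
  \<open>X\<close> in \<open>e\<close> alone.\<close>

lemma fundamental_cocircuit:
  assumes "X \<in> C" "e \<in> supp X" "f \<in> supp X" "e \<noteq> f"
  obtains Y where "Y \<in> D" "supp X \<inter> supp Y = {e, f}"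
proof -
  have "e \<in> E" "e \<notin> supp X - {e, f}" using assms supp_sub by auto
  with painting show ?thesis
  proof (cases rule: paintingD)
    case (1 X')
    then have "supp X' \<subseteq> supp X" "f \<notin> supp X'" using assms by auto
    then show ?thesis using supp_clutter[OF 1(1) assms(1)] assms(3) by blast
  next
    case (2 Y)
    then have "supp X \<inter> supp Y \<subseteq> {e, f}" "e \<in> supp X \<inter> supp Y" using assms by auto
    then have "supp X \<inter> supp Y = {e, f}" using neq_singleton[OF assms(1) 2(1), of e] by blast
    then show ?thesis using that 2 by blast
  qed
qed

lemma C2_pair: "C2 C"
  unfolding C2_def
proof (intro ballI impI)
  fix X X' assume X: "X \<in> C" and X': "X' \<in> C" and "supp X \<subseteq> supp X'"
  then have eq: "supp X = supp X'" using supp_clutter by blast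
  obtain e where e: "e \<in> supp X" using supp_nonempty[OF X] by blast
  then obtain a where "a * X' e = X e" using ex_mult_eq eq by (metis (mono_tags) mem_Collect_eq supp_def)
  then have a: "X e = a * X' e" by simp
  then have a0: "a \<noteq> 0" using e by (auto simp: supp_def)
  have "X f = a * X' f" for f
  proof (cases "f \<in> supp X \<and> f \<noteq> e")
    case True
    then obtain Y where Y: "Y \<in> D" "supp X \<inter> supp Y = {e, f}"
      using fundamental_cocircuit[OF X e] by metis
    have ef: "e \<in> E" "f \<in> E" "e \<noteq> f" using True e supp_sub[OF X] by auto
    have "X e * Y e = - (X f * Y f)" "X' e * Y e = - (X' f * Y f)"
      using orthogonal_pair[OF finite_ground ef, of _ Y] orth[OF X Y(1)] orth[OF X' Y(1)] Y(2) eq by auto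
    moreover have "Y f \<noteq> 0" using Y by (auto simp: supp_def)
    ultimately show ?thesis using a orthogonal_transfer_scale by blast
  next
    case False
    then have "f = e \<or> f \<notin> supp X \<and> f \<notin> supp X'" using eq by auto
    then show ?thesis using a by (auto simp: supp_def)
  qed
  then show "\<exists>a. a \<noteq> 0 \<and> X = (\<lambda>e. a * X' e)" using a0 by blast
qed

text \<open>Painting against the complement of \<open>supp W\<close> gives an element of
  \<open>D\<close> inside \<open>W\<close>, and minimality makes the supports equal. Circuits that
  meet \<open>W\<close> in just two elements, again found by painting, fix the ratios. Orthogonality
  to cocircuits thereby reduces to orthogonality to \<open>D\<close>.\<close>

lemma cocircuit_from_dual:
  assumes "W \<in> cocircuits E C"
  obtains Y a where "Y \<in> D" "supp Y = supp W" "W = (\<lambda>e. a * Y e)"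
proof -
  have W: "W \<in> covectors E C" "W \<noteq> (\<lambda>_. 0)"
    and W_min: "\<And>W'. W' \<in> covectors E C \<Longrightarrow> W' \<noteq> (\<lambda>_. 0) \<Longrightarrow> \<not> supp W' \<subset> supp W"
    using assms unfolding cocircuits_def by auto
  have D_cov: "Y \<in> covectors E C" if "Y \<in> D" for Y
    using that D_sub orth orthogonal_commute unfolding covectors_def by blast
  have W_orth: "orthogonal E X W" if "X \<in> C" for X
    using W that orthogonal_commute unfolding covectors_def by blast
  then have W_neq: "supp X \<inter> supp W \<noteq> {e}" if "X \<in> C" for X e
    using orthogonal_neq_singleton[OF finite_ground _ W_orth] C_sub that by blast
  have WE: "supp W \<subseteq> E" using W by (auto simp: covectors_def funspace_def)
  obtain e where e: "e \<in> supp W" using W supp_eq_empty by blast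
  obtain Y where Y: "Y \<in> D" "e \<in> supp Y" "supp Y \<subseteq> supp W"
  proof -
    have "e \<in> E" "e \<notin> E - supp W" using e WE by auto
    with painting show ?thesis
    proof (cases rule: paintingD)
      case (1 X)
      then have "supp X \<inter> supp W = {e}" using e by auto
      then show ?thesis using W_neq 1 by blast
    next
      case (2 Y)
      then have "supp Y \<subseteq> supp W" using D_sub by (auto simp: funspace_def)
      then show ?thesis using that 2 by blast
    qed
  qed
  then have "Y \<noteq> (\<lambda>_. 0)" by (auto simp: supp_def)
  then have eq: "supp Y = supp W" using W_min[OF D_cov[OF Y(1)]] Y by blast
  obtain a where "a * Y e = W e" using ex_mult_eq Y(2) by (metis (mono_tags) mem_Collect_eq supp_def)
  then have a: "W e = a * Y e" by simp
  have "W f = a * Y f" for f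
  proof (cases "f \<in> supp W \<and> f \<noteq> e")
    case True
    obtain X where X: "X \<in> C" "supp X \<inter> supp W = {e, f}"
    proof -
      have "e \<in> E" "e \<notin> insert f (E - supp W)" using e WE True by auto
      with painting show ?thesis
      proof (cases rule: paintingD)
        case (1 X)
        then have "supp X \<inter> supp W \<subseteq> {e, f}" "e \<in> supp X \<inter> supp W" using e by auto
        then have "supp X \<inter> supp W = {e, f}" using W_neq[OF 1(1), of e] by blast
        then show ?thesis using that 1 by blast
      next
        case (2 Y')
        then have "supp Y' \<subset> supp W" using D_sub True by (auto simp: funspace_def)
        moreover have "Y' \<noteq> (\<lambda>_. 0)" using 2 by (auto simp: supp_def)
        ultimately show ?thesis using W_min[OF D_cov[OF 2(1)]] by blast
      qed
    qed
    have ef: "e \<in> E" "f \<in> E" "e \<noteq> f" using True e WE by auto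
    have "X e * W e = - (X f * W f)" "X e * Y e = - (X f * Y f)"
      using orthogonal_pair[OF finite_ground ef, of X] W_orth[OF X(1)] orth[OF X(1) Y(1)] X(2) eq by auto
    then have "W e * X e = - (W f * X f)" "Y e * X e = - (Y f * X f)" by (simp_all add: mult.commute)
    moreover have "X f \<noteq> 0" using X by (auto simp: supp_def)
    ultimately show ?thesis using a orthogonal_transfer_scale by blast
  next
    case False
    then have "f = e \<or> f \<notin> supp W \<and> f \<notin> supp Y" using eq by auto
    then show ?thesis using a by (auto simp: supp_def)
  qed
  then show ?thesis using that Y eq by blast
qed

text \<open>Modularity makes \<open>T\<close>, the union \<open>U\<close> without \<open>p\<close>
  and all \<open>e i\<close>, a basis of \<open>U\<close>. The eliminant can only be the fundamental
  circuit of \<open>p\<close> over \<open>T\<close>, scaled to agree with \<open>X\<close> at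
  \<open>p\<close>. Its value at \<open>f\<close> in \<open>T\<close> is read off from a dual
  element that meets \<open>T\<close> in \<open>f\<close> only.\<close>

lemma C3_pair: "C3 C"
  unfolding C3_def
proof (intro allI impI, elim conjE)
  fix k :: nat and Xs :: "nat \<Rightarrow> 'e \<Rightarrow> 'f" and X and e :: "nat \<Rightarrow> 'e"
  let ?I = "{1..k}"
  assume Xs: "\<forall>i\<in>?I. Xs i \<in> C" and X: "X \<in> C"
    and modular: "modular_family C (k + 1) (insert X (Xs ` ?I))"
    and "\<not> supp X \<subseteq> (\<Union>i\<in>?I. supp (Xs i))"
    and e_props: "\<forall>i\<in>?I. e i \<in> (supp X \<inter> supp (Xs i)) - (\<Union>j\<in>?I - {i}. supp (Xs j)) \<and>
      X (e i) = - Xs i (e i) \<and> X (e i) \<noteq> 0"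
  then obtain p where p: "p \<in> supp X" "\<And>i. i \<in> ?I \<Longrightarrow> p \<notin> supp (Xs i)" by blast
  have e: "e i \<in> supp X" "e i \<in> supp (Xs i)" "X (e i) = - Xs i (e i)" if "i \<in> ?I" for i
    using e_props that by auto
  have e_other: "e i \<notin> supp (Xs j)" if "i \<in> ?I" "j \<in> ?I" "i \<noteq> j" for i j
    using bspec[OF e_props that(1)] that(2,3) by auto
  have inj: "inj_on e ?I" using e e_other by (metis inj_onI)
  define U where "U = supp X \<union> (\<Union>i\<in>?I. supp (Xs i))"
  define T where "T = U - insert p (e ` ?I)"
  have UE: "U \<subseteq> E" using supp_sub X Xs unfolding U_def by blast
  have XU: "supp X \<subseteq> U" "\<And>i. i \<in> ?I \<Longrightarrow> supp (Xs i) \<subseteq> U" unfolding U_def by auto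
  have T_indep: "\<not> supp W \<subseteq> T" if W: "W \<in> C" for W
  proof
    assume WT: "supp W \<subseteq> T"
    \<comment> \<open>A circuit inside \<open>T\<close> starts a chain that is one step too long:
      adding \<open>Xs i\<close> contributes \<open>e i\<close>, and the last step to
      \<open>U\<close> contributes \<open>p\<close>.\<close>
    define c where "c m = (if m = 0 then {} else if m \<le> k + 1
      then supp W \<union> (\<Union>j\<in>{1..m - 1}. supp (Xs j)) else U)" for m
    let ?L = "support_unions C"
    have "c m \<in> ?L" if m: "m \<le> k + 2" for m
    proof -
      consider "m = 0" | "m \<noteq> 0" "m \<le> k + 1" | "m = k + 2" using m by linarith
      then show ?thesis
      proof cases
        case 1
        then have "c m = \<Union>(supp ` {})" by (simp add: c_def)
        then show ?thesis unfolding support_unions_def by blast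
      next
        case 2
        then have "c m = \<Union>(supp ` insert W (Xs ` {1..m - 1}))" by (simp add: c_def)
        moreover have "insert W (Xs ` {1..m - 1}) \<subseteq> C" using W Xs 2 by auto
        ultimately show ?thesis unfolding support_unions_def by blast
      next
        case 3
        then have "c m = \<Union>(supp ` insert X (Xs ` ?I))" by (simp add: c_def U_def)
        moreover have "insert X (Xs ` ?I) \<subseteq> C" using X Xs by auto
        ultimately show ?thesis unfolding support_unions_def by blast
      qed
    qed
    moreover have "c m \<subset> c (Suc m)" if "m < k + 2" for m
    proof -
      consider "m = 0" | i where "m = Suc i" "i < k" | "m = k + 1"
        using \<open>m < k + 2\<close> by (cases m) (auto simp: less_Suc_eq)
      then show ?thesis
      proof cases
        case 1
        then show ?thesis using supp_nonempty[OF W] by (auto simp: c_def)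
      next
        case 2
        then have "c m = supp W \<union> (\<Union>j\<in>{1..i}. supp (Xs j))"
          "c (Suc m) = supp W \<union> (\<Union>j\<in>{1..Suc i}. supp (Xs j))" by (simp_all add: c_def)
        moreover have "e (Suc i) \<notin> supp W" using WT 2 unfolding T_def by auto
        moreover have "e (Suc i) \<in> supp (Xs (Suc i))" using e 2 by simp
        moreover have "e (Suc i) \<notin> supp (Xs j)" if "j \<in> {1..i}" for j
          using e_other[of "Suc i" j] 2 that by simp
        ultimately show ?thesis by (auto simp: atLeastAtMostSuc_conv)
      next
        case 3
        then have "c m = supp W \<union> (\<Union>j\<in>?I. supp (Xs j))" "c (Suc m) = U" by (simp_all add: c_def)
        moreover have "p \<in> U" "p \<notin> supp W" using WT p(1) XU(1) unfolding T_def by auto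
        moreover have "supp W \<subseteq> U" using WT unfolding T_def by blast
        ultimately show ?thesis using p(2) XU(2) by blast
      qed
    qed
    moreover have "finite U" using UE finite_ground finite_subset by blast
    moreover have "c (k + 2) = U" by (simp add: c_def)
    ultimately have "k + 2 \<le> height ?L U" by (intro height_ge[of U "k + 2" c]) auto
    moreover have "height ?L U = k + 1" using modular unfolding modular_family_def U_def by simp
    ultimately show False by simp
  qed
  have other: "supp (Xs i) \<inter> supp Y \<subseteq> insert (e i) S" if "supp Y \<inter> U \<subseteq> insert p (e ` ?I \<union> S)" "i \<in> ?I" for Y i S
    using that XU(2)[of i] p(2)[of i] e_other by blast
  obtain Z0 where Z0: "Z0 \<in> C" "p \<in> supp Z0" "supp Z0 \<subseteq> insert p T"
  proof -
    have "p \<in> E" "p \<notin> T" using p XU UE by (auto simp: T_def)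
    with painting show ?thesis
    proof (cases rule: paintingD)
      case (1 Z)
      then show ?thesis using that by blast
    next
      case (2 Y)
      then have YU: "supp Y \<inter> U \<subseteq> insert p (e ` ?I \<union> {})" by (auto simp: T_def)
      \<comment> \<open>Otherwise \<open>Y\<close> would meet \<open>Xs i\<close> in
        \<open>e i\<close> alone. What is left of \<open>Y\<close> in \<open>U\<close> is just
        \<open>p\<close>, where it would meet \<open>X\<close> alone.\<close>
      have "e i \<notin> supp Y" if "i \<in> ?I" for i
        using other[OF YU that] neq_singleton[of "Xs i" Y "e i"] Xs that 2(1) e(2)[OF that] by blast
      then have "supp X \<inter> supp Y = {p}" using YU XU(1) p 2 by blast
      then show ?thesis using neq_singleton X 2 by blast
    qed
  qed
  obtain a where a: "a * Z0 p = X p" using ex_mult_eq Z0(2) by (metis (mono_tags) mem_Collect_eq supp_def)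
  then have a0: "a \<noteq> 0" using p by (auto simp: supp_def)
  define Z where "Z = (\<lambda>f. a * Z0 f)"
  have Z: "Z \<in> C" "supp Z \<subseteq> insert p T" "Z p = X p"
    using Z0 a a0 scale_mem by (auto simp: Z_def supp_scale)
  have pe: "p \<noteq> e i" if "i \<in> ?I" for i using p e that by blast
  have Ze: "Z (e i) = 0" if "i \<in> ?I" for i
    using Z(2) pe[OF that] that by (auto simp: T_def supp_def)
  have "Z f \<in> {X f} \<boxplus>\<^sub>S hsum (\<lambda>i. {Xs i f}) ?I" for f
  proof -
    consider "f \<notin> U" | "f = p" | i where "i \<in> ?I" "f = e i" | "f \<in> T" unfolding T_def by blast
    then show ?thesis
    proof cases
      case 1
      then have "X f = 0" "\<And>i. i \<in> ?I \<Longrightarrow> Xs i f = 0" "Z f = 0"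
        using XU Z(2) p(1) unfolding T_def supp_def by blast+
      then show ?thesis by (simp add: hsum.neutral)
    next
      case 2
      then have "\<And>i. i \<in> ?I \<Longrightarrow> Xs i f = 0" using p(2) by (simp add: supp_def)
      then show ?thesis using 2 Z(3) by (simp add: hsum.neutral)
    next
      case 3
      have "hsum (\<lambda>j. {Xs j f}) ?I = {Xs i f} \<boxplus>\<^sub>S hsum (\<lambda>j. {Xs j f}) (?I - {i})"
        using 3 by (intro hsum.remove) auto
      also have "hsum (\<lambda>j. {Xs j f}) (?I - {i}) = {0}"
        using 3 e_other by (intro hsum.neutral) (auto simp: supp_def)
      finally show ?thesis using 3 Ze e(3) by (simp add: zero_in_hadd_iff)
    next
      case 4
      then have f: "f \<in> E" "f \<notin> T - {f}" "f \<in> U" "f \<noteq> p" "f \<notin> e ` ?I" using UE by (auto simp: T_def)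
      obtain Y where Y: "Y \<in> D" "f \<in> supp Y" "supp Y \<inter> (T - {f}) = {}"
        using painting f(1,2)
      proof (cases rule: paintingD)
        case (1 W)
        then have "supp W \<subseteq> T" using 4 by blast
        then show ?thesis using T_indep 1 by blast
      qed (use that in blast)
      have YU: "supp Y \<inter> U \<subseteq> insert p (e ` ?I \<union> {f})" using Y(3) unfolding T_def by blast
      have "supp Z \<inter> supp Y \<subseteq> {p, f}" using Z(2) Y(3) by blast
      moreover have "p \<in> E" using p XU UE by blast
      ultimately have "Z p * Y p = - (Z f * Y f)"
        using orthogonal_pair[of E p f Z Y] orth[OF Z(1) Y(1)] finite_ground f by simp
      then have Xp: "X p * Y p = - (Z f * Y f)" using Z(3) by simp
      have Xe: "X (e i) * Y (e i) = Y f * Xs i f" if i: "i \<in> ?I" for i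
      proof -
        have "e i \<in> E" "f \<noteq> e i" using e(1)[OF i] XU UE f(5) i by auto
        then have "Xs i (e i) * Y (e i) = - (Xs i f * Y f)"
          using orthogonal_pair[of E "e i" f "Xs i" Y] orth Xs i Y(1) other[OF YU i] finite_ground f(1) by simp
        then show ?thesis using e(3)[OF i] by (simp add: mult_hneg_right mult.commute)
      qed
      \<comment> \<open>With the terms at \<open>p\<close> and \<open>e i\<close> replaced according
        to \<open>Xp\<close> and \<open>Xe\<close>, this relation is the claim at \<open>f\<close>
        multiplied by \<open>Y f\<close>.\<close>
      have "orthogonal E X Y" using orth X Y by blast
      moreover have "supp X \<inter> supp Y \<subseteq> insert p (insert f (e ` ?I))" using YU XU by blast
      moreover have "insert p (insert f (e ` ?I)) \<subseteq> E" using e(1) XU UE f(1) \<open>p \<in> E\<close> by blast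
      ultimately have "orthogonal (insert p (insert f (e ` ?I))) X Y"
        using orthogonal_restrict[OF finite_ground] by blast
      moreover have "p \<notin> insert f (e ` ?I)" using f pe by blast
      ultimately have "0 \<in> {X p * Y p} \<boxplus>\<^sub>S ({X f * Y f} \<boxplus>\<^sub>S hsum (\<lambda>x. {X x * Y x}) (e ` ?I))"
        using f(5) by (simp add: orthogonal_def)
      then have "Z f * Y f \<in> {X f * Y f} \<boxplus>\<^sub>S hsum (\<lambda>x. {X x * Y x}) (e ` ?I)"
        using Xp by (simp add: zero_in_hadd_set_singleton)
      also have "hsum (\<lambda>x. {X x * Y x}) (e ` ?I) = hsum (\<lambda>i. {Y f * Xs i f}) ?I"
        using inj Xe by (simp add: hsum.reindex)
      also have "\<dots> = (*) (Y f) ` hsum (\<lambda>i. {Xs i f}) ?I" by (simp add: hsum_distrib)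
      also have "{X f * Y f} = (*) (Y f) ` {X f}" by (simp add: mult.commute)
      finally have "Y f * Z f \<in> (*) (Y f) ` ({X f} \<boxplus>\<^sub>S hsum (\<lambda>i. {Xs i f}) ?I)"
        by (simp only: hadd_set_distrib mult.commute[of "Y f" "Z f"])
      then obtain w where "w \<in> {X f} \<boxplus>\<^sub>S hsum (\<lambda>i. {Xs i f}) ?I" "Y f * Z f = Y f * w"
        by (rule imageE)
      moreover have "Y f \<noteq> 0" using Y(2) by (simp add: supp_def)
      ultimately show ?thesis by (simp add: hmult_cancel)
    qed
  qed
  then show "\<exists>Z\<in>C. (\<forall>i\<in>?I. Z (e i) = 0) \<and> (\<forall>f. Z f \<in> {X f} \<boxplus>\<^sub>S hsum (\<lambda>i. {Xs i f}) ?I)"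
    using Z(1) Ze by blast
qed

lemma strong: "strong_matroid E C"
  using finite_ground C_sub zero_notin scale_mem C2_pair C3_pair
  by (simp add: strong_matroid_def C0_def C1_def)

end

section \<open>Minors\<close>

text \<open>Moving one element from the deleted to the contracted part changes the rank of a minor by
  at most one. For \<open>A = X0 - Y0\<close> the minor on \<open>S\<close> has rank \<open>card S - 1\<close> and for
  \<open>A = E - Y0\<close> it has rank \<open>1\<close>, so for some \<open>A\<close> in between \<open>S\<close> is neither a circuit nor a
  cocircuit of the minor. The painting property replaces the rank.\<close>

lemma proper_minor_exists:
  assumes "finite E" and CD: "C \<subseteq> funspace E" "D \<subseteq> funspace E" and paint: "painting E C D"
    and not1: "\<And>X Y e. X \<in> C \<Longrightarrow> Y \<in> D \<Longrightarrow> supp X \<inter> supp Y \<noteq> {e}"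
    and X0: "X0 \<in> C" "\<And>X. X \<in> C \<Longrightarrow> supp X \<subseteq> supp X0 \<Longrightarrow> supp X = supp X0"
    and Y0: "Y0 \<in> D" "\<And>Y. Y \<in> D \<Longrightarrow> supp Y \<subseteq> supp Y0 \<Longrightarrow> supp Y = supp Y0"
    and S: "S = supp X0 \<inter> supp Y0" "4 \<le> card S"
  obtains A X1 Y1 where "supp X0 \<subseteq> S \<union> A" "supp Y0 \<inter> A = {}"
    "X1 \<in> C" "supp X1 \<subseteq> S \<union> A" "supp X1 \<inter> S \<noteq> {}" "\<not> S \<subseteq> supp X1"
    "Y1 \<in> D" "supp Y1 \<inter> A = {}" "supp Y1 \<inter> S \<noteq> {}" "\<not> S \<subseteq> supp Y1"
proof -
  obtain e f g h where S4: "e \<in> S" "f \<in> S" "g \<in> S" "h \<in> S"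
    and distinct: "e \<noteq> f" "e \<noteq> g" "e \<noteq> h" "f \<noteq> g" "f \<noteq> h" "g \<noteq> h"
    using S(2) by (auto simp: numeral_eq_Suc card_le_Suc_iff)
  have sub: "supp X0 \<subseteq> E" "\<And>Y. Y \<in> D \<Longrightarrow> supp Y \<subseteq> E" using X0 CD by (auto simp: funspace_def)
  then have SE: "S \<subseteq> E" using S by blast
  \<comment> \<open>In the minor that contracts \<open>A\<close>, \<open>c A\<close> leaves
    \<open>S\<close> as the only possible circuit and \<open>d A\<close> leaves it as the only
    possible cocircuit, so the rank is at least \<open>card S - 1\<close> or at most 1,
    respectively.\<close>
  define c where "c A \<longleftrightarrow> (\<forall>X\<in>C. supp X \<subseteq> S \<union> A \<longrightarrow> supp X \<inter> S \<noteq> {} \<longrightarrow> S \<subseteq> supp X)" for A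
  define d where "d A \<longleftrightarrow> (\<forall>Y\<in>D. supp Y \<inter> A = {} \<longrightarrow> supp Y \<inter> S \<noteq> {} \<longrightarrow> S \<subseteq> supp Y)" for A
  define F where "F = {A. supp X0 - supp Y0 \<subseteq> A \<and> A \<subseteq> E - supp Y0 \<and> c A}"
  have "c (supp X0 - supp Y0)"
    unfolding c_def
  proof (intro ballI impI)
    fix X assume "X \<in> C" "supp X \<subseteq> S \<union> (supp X0 - supp Y0)"
    then have "supp X = supp X0" using X0(2) S(1) by blast
    then show "S \<subseteq> supp X" using S(1) by blast
  qed
  then have "supp X0 - supp Y0 \<in> F" using sub by (auto simp: F_def)
  moreover have "finite F" using assms(1) by (intro finite_subset[of F "Pow E"]) (auto simp: F_def)
  ultimately obtain M where M: "M \<in> F" "\<And>M'. M' \<in> F \<Longrightarrow> M \<subseteq> M' \<Longrightarrow> M = M'"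
    using finite_maximal_set by blast
  then have M_props: "supp X0 - supp Y0 \<subseteq> M" "M \<subseteq> E - supp Y0" and cM: "c M"
    by (auto simp: F_def)
  have MS: "x \<notin> M" if "x \<in> S" for x using M_props(2) that S(1) by blast
  have "\<not> d M"
  proof
    assume dM: "d M"
    have "e \<in> E" "e \<notin> insert f M" using S4 SE distinct MS by auto
    with paint show False
    proof (cases rule: paintingD)
      case (1 X)
      then have "supp X \<subseteq> S \<union> M" "supp X \<inter> S \<noteq> {}" "g \<notin> supp X"
        using S4 distinct MS by auto
      then show False using cM 1(1) S4 unfolding c_def by blast
    next
      case (2 Y)
      then have "supp Y \<inter> M = {}" "supp Y \<inter> S \<noteq> {}" "f \<notin> supp Y" using S4 by auto
      then show False using dM 2(1) S4 unfolding d_def by blast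
    qed
  qed
  moreover have "d (E - supp Y0)"
    unfolding d_def
  proof (intro ballI impI)
    fix Y assume "Y \<in> D" "supp Y \<inter> (E - supp Y0) = {}"
    then have "supp Y = supp Y0" using Y0(2) sub(2) by blast
    then show "S \<subseteq> supp Y" using S(1) by blast
  qed
  ultimately have "M \<noteq> E - supp Y0" by blast
  then obtain z where z: "z \<in> E" "z \<notin> supp Y0" "z \<notin> M" using M_props by blast
  have zS: "z \<notin> S" using z S(1) by blast
  let ?M = "insert z M"
  have "?M \<notin> F" using M(2)[of ?M] z by blast
  then have ncM: "\<not> c ?M" using M_props z by (auto simp: F_def)
  \<comment> \<open>Contracting the single element \<open>z\<close> cannot lead from
    \<open>c\<close> to \<open>d\<close>: paintings of \<open>g\<close> and of \<open>e\<close>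
    would give a dual element and a circuit that meet in \<open>z\<close> alone. The fourth element
    \<open>h\<close> rules out the wrong outcome of the first painting.\<close>
  have "\<not> d ?M"
  proof
    assume dM: "d ?M"
    obtain Y where Y: "Y \<in> D" "z \<in> supp Y" "supp Y \<inter> insert e (insert f M) = {}"
    proof -
      have "g \<in> E" "g \<notin> insert e (insert f M)" using S4 SE distinct MS by auto
      with paint show ?thesis
      proof (cases rule: paintingD)
        case (1 X)
        then have "supp X \<subseteq> S \<union> M" "supp X \<inter> S \<noteq> {}" "h \<notin> supp X"
          using S4 distinct MS by auto
        then show ?thesis using cM 1(1) S4 unfolding c_def by blast
      next
        case (2 Y)
        then have "supp Y \<inter> S \<noteq> {}" "\<not> S \<subseteq> supp Y" using S4 by auto
        then have "supp Y \<inter> ?M \<noteq> {}" using dM 2(1) unfolding d_def by blast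
        then have "z \<in> supp Y" using 2 by blast
        then show ?thesis using that 2 by blast
      qed
    qed
    obtain X where X: "X \<in> C" "z \<in> supp X" "supp X \<subseteq> insert z (insert e (insert f M))"
    proof -
      have "e \<in> E" "e \<notin> insert f ?M" using S4 SE distinct MS zS by auto
      with paint show ?thesis
      proof (cases rule: paintingD)
        case (1 X)
        then have "supp X \<inter> S \<noteq> {}" "\<not> S \<subseteq> supp X" using S4 distinct MS zS by auto
        then have "\<not> supp X \<subseteq> S \<union> M" using cM 1(1) unfolding c_def by blast
        then have "z \<in> supp X" using 1(3) S4 by blast
        then show ?thesis using that 1 by blast
      next
        case (2 Y)
        then have "supp Y \<inter> ?M = {}" "supp Y \<inter> S \<noteq> {}" "f \<notin> supp Y" using S4 by auto
        then show ?thesis using dM 2(1) S4 unfolding d_def by blast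
      qed
    qed
    have "supp X \<inter> supp Y = {z}" using X Y by blast
    then show False using not1 X(1) Y(1) by blast
  qed
  then obtain Y1 where Y1: "Y1 \<in> D" "supp Y1 \<inter> ?M = {}" "supp Y1 \<inter> S \<noteq> {}" "\<not> S \<subseteq> supp Y1"
    unfolding d_def by blast
  obtain X1 where X1: "X1 \<in> C" "supp X1 \<subseteq> S \<union> ?M" "supp X1 \<inter> S \<noteq> {}" "\<not> S \<subseteq> supp X1"
    using ncM unfolding c_def by blast
  have "supp X0 \<subseteq> S \<union> ?M" "supp Y0 \<inter> ?M = {}" using M_props z S(1) by blast+
  then show ?thesis by (rule that[OF _ _ X1 Y1])
qed

text \<open>Restriction to the ground set of a minor and relabelling in one step, because
  \<open>perfect_hyperfield\<close> speaks of ground sets of natural numbers.\<close>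

definition pull :: "nat \<Rightarrow> (nat \<Rightarrow> 'e) \<Rightarrow> ('e \<Rightarrow> 'f::zero) \<Rightarrow> nat \<Rightarrow> 'f"
  where "pull n g X = (\<lambda>i. if i < n then X (g i) else 0)"

lemma supp_pull: "supp (pull n g X) = {i. i < n \<and> g i \<in> supp X}"
  by (auto simp: pull_def supp_def)

lemma pull_in_funspace: "pull n g X \<in> funspace {..<n}"
  by (auto simp: funspace_def supp_pull)

lemma orthogonal_pull:
  assumes "finite E" "S \<subseteq> E" "bij_betw g {..<n} S" "supp X \<inter> supp Y \<subseteq> S"
  shows "orthogonal {..<n} (pull n g X) (pull n g Y) \<longleftrightarrow> orthogonal E X Y"
proof -
  have "hsum (\<lambda>e. {X e * Y e}) S = hsum (\<lambda>i. {X (g i) * Y (g i)}) {..<n}"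
    using assms(3) by (rule hsum.reindex_bij_betw[symmetric])
  also have "\<dots> = hsum (\<lambda>i. {pull n g X i * pull n g Y i}) {..<n}"
    by (rule hsum.cong) (auto simp: pull_def)
  finally show ?thesis
    using orthogonal_restrict[OF assms(1,2,4)] by (simp add: orthogonal_def)
qed

text \<open>The minor contracts \<open>A\<close> and deletes the rest of \<open>E - S\<close>. Its
  paintings are those of the whole ground set in which \<open>A\<close> is added to the class
  \<open>R\<close>.\<close>

lemma painting_pull:
  assumes "painting E C D" "bij_betw g {..<n} S" "S \<subseteq> E" "A \<inter> S = {}"
  shows "painting {..<n} (pull n g ` {X \<in> C. supp X \<subseteq> S \<union> A}) (pull n g ` {Y \<in> D. supp Y \<inter> A = {}})"
    (is "painting _ ?C ?D")
  unfolding painting_def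
proof (intro ballI allI impI)
  fix i R assume i: "i \<in> {..<n}" "i \<notin> R"
  have g: "g i \<in> S" and inj: "inj_on g {..<n}" using assms(2) i by (auto simp: bij_betw_def)
  have "g i \<in> E" "g i \<notin> g ` (R \<inter> {..<n}) \<union> A"
    using g assms(3,4) i inj by (auto simp: inj_on_def)
  with assms(1) show "(\<exists>X\<in>?C. i \<in> supp X \<and> supp X \<subseteq> insert i R) \<or> (\<exists>Y\<in>?D. i \<in> supp Y \<and> supp Y \<inter> R = {})"
  proof (cases rule: paintingD)
    case (1 X)
    have "g ` {..<n} = S" using assms(2) by (simp add: bij_betw_def)
    then have "supp X \<subseteq> S \<union> A" using 1 g by blast
    moreover have "supp (pull n g X) \<subseteq> insert i R"
    proof
      fix j assume "j \<in> supp (pull n g X)"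
      then have j: "j < n" "g j \<in> supp X" by (simp_all add: supp_pull)
      then have "g j \<in> S" using \<open>g ` {..<n} = S\<close> by blast
      then have "g j \<in> g ` insert i (R \<inter> {..<n})" using 1(3) j(2) assms(4) by blast
      then have "j \<in> insert i (R \<inter> {..<n})"
        using inj_on_image_mem_iff[OF inj, of j "insert i (R \<inter> {..<n})"] j(1) i(1) by auto
      then show "j \<in> insert i R" by blast
    qed
    moreover have "i \<in> supp (pull n g X)" using 1 i by (simp add: supp_pull)
    ultimately show ?thesis using 1(1) by blast
  next
    case (2 Y)
    then have "supp Y \<inter> A = {}" by blast
    moreover have "supp (pull n g Y) \<inter> R = {}" using 2(3) by (auto simp: supp_pull)
    moreover have "i \<in> supp (pull n g Y)" using 2 i by (simp add: supp_pull)
    ultimately show ?thesis using 2(1) by blast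
  qed
qed

section \<open>Weak matroids over perfect hyperfields\<close>

text \<open>The induction stays with \<open>C\<close> and \<open>D\<close> on \<open>E\<close>:
  orthogonality of a pair in the minor is orthogonality of the pair it is restricted from, since
  common elements outside \<open>S\<close> do not occur.\<close>

lemma perfect_imp_orthogonal:
  fixes C D :: "('e \<Rightarrow> 'f::hyperfield) set"
  assumes perfect: "perfect_hyperfield TYPE('f)"
    and fin: "finite E" and CD: "C \<subseteq> funspace E" "D \<subseteq> funspace E" and paint: "painting E C D"
    and scale: "\<And>X a. X \<in> C \<Longrightarrow> a \<noteq> 0 \<Longrightarrow> (\<lambda>e. a * X e) \<in> C"
    and C_clutter: "\<And>X X'. X \<in> C \<Longrightarrow> X' \<in> C \<Longrightarrow> supp X \<subseteq> supp X' \<Longrightarrow> supp X = supp X'"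
    and D_clutter: "\<And>Y Y'. Y \<in> D \<Longrightarrow> Y' \<in> D \<Longrightarrow> supp Y \<subseteq> supp Y' \<Longrightarrow> supp Y = supp Y'"
    and orth3: "\<And>X Y. X \<in> C \<Longrightarrow> Y \<in> D \<Longrightarrow> card (supp X \<inter> supp Y) \<le> 3 \<Longrightarrow> orthogonal E X Y"
    and "X \<in> C" "Y \<in> D"
  shows "orthogonal E X Y"
  using assms(10,11)
proof (induction "card (supp X \<inter> supp Y)" arbitrary: X Y rule: less_induct)
  case (less X0 Y0)
  show ?case
  proof (cases "card (supp X0 \<inter> supp Y0) \<le> 3")
    case True
    then show ?thesis using orth3 less.prems by blast
  next
    case False
    define S where "S = supp X0 \<inter> supp Y0"
    define n where "n = card S"
    have not1: "supp X \<inter> supp Y \<noteq> {e}" if "X \<in> C" "Y \<in> D" for X Y e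
    proof
      assume single: "supp X \<inter> supp Y = {e}"
      then have "orthogonal E X Y" using orth3 that by simp
      then show False
        using orthogonal_neq_singleton[OF fin _ \<open>orthogonal E X Y\<close>, of e] single CD(1) that(1) by blast
    qed
    have card4: "4 \<le> card S" using False by (simp add: S_def)
    obtain A X1 Y1 where A: "supp X0 \<subseteq> S \<union> A" "supp Y0 \<inter> A = {}"
      and X1: "X1 \<in> C" "supp X1 \<subseteq> S \<union> A" "supp X1 \<inter> S \<noteq> {}" "\<not> S \<subseteq> supp X1"
      and Y1: "Y1 \<in> D" "supp Y1 \<inter> A = {}" "supp Y1 \<inter> S \<noteq> {}" "\<not> S \<subseteq> supp Y1"
      by (rule proper_minor_exists[OF fin CD paint not1 less.prems(1) C_clutter[OF _ less.prems(1)]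
          less.prems(2) D_clutter[OF _ less.prems(2)] S_def card4])
    have SE: "S \<subseteq> E" using less.prems(1) CD by (auto simp: S_def funspace_def)
    have SA: "A \<inter> S = {}" using A(2) S_def by blast
    have finS: "finite S" using SE fin finite_subset by blast
    obtain g where g: "bij_betw g {..<n} S"
      using ex_bij_betw_nat_finite[OF finS] by (auto simp: n_def lessThan_atLeast0)
    let ?p = "pull n g"
    define C' where "C' = ?p ` {X \<in> C. supp X \<subseteq> S \<union> A}"
    define D' where "D' = ?p ` {Y \<in> D. supp Y \<inter> A = {}}"
    have p_orth: "orthogonal {..<n} (?p X) (?p Y) \<longleftrightarrow> orthogonal E X Y"
      if "supp X \<subseteq> S \<union> A" "supp Y \<inter> A = {}" for X Y
      using that by (intro orthogonal_pull[OF fin SE g]) blast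
    \<comment> \<open>The common support lies in \<open>S\<close>, so missing one element of
      \<open>S\<close> is enough for the induction hypothesis.\<close>
    have p_small: "orthogonal {..<n} (?p X) (?p Y)"
      if XY: "X \<in> C" "supp X \<subseteq> S \<union> A" "Y \<in> D" "supp Y \<inter> A = {}" and small: "\<not> S \<subseteq> supp X \<inter> supp Y" for X Y
    proof -
      have "supp X \<inter> supp Y \<subset> S" using XY small by blast
      then have "card (supp X \<inter> supp Y) < card (supp X0 \<inter> supp Y0)"
        using finS by (simp add: psubset_card_mono flip: S_def)
      then show ?thesis using less.hyps XY p_orth by blast
    qed
    have p_mono: "S \<subseteq> supp X" if "{..<n} \<subseteq> supp (?p X)" for X
      using that g by (auto simp: supp_pull bij_betw_def)
    have p_less: "supp (?p X) \<subset> {..<n}" if "\<not> S \<subseteq> supp X" for X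
      using p_mono[of X] that by (auto simp: supp_pull)
    have p_nonzero: "?p X \<noteq> (\<lambda>_. 0)" if X: "supp X \<inter> S \<noteq> {}" for X
    proof -
      obtain i where "i < n" "g i \<in> supp X" using X g by (auto simp: bij_betw_def)
      then have "i \<in> supp (?p X)" by (simp add: supp_pull)
      then show ?thesis by (auto simp: supp_def)
    qed
    \<comment> \<open>\<open>X1\<close> restricts to a non-zero function that misses part of
      \<open>S\<close>, so a full support is not minimal.\<close>
    have not_all: "\<not> {..<n} \<subseteq> supp X" if "X \<in> minsupp C'" for X
    proof
      assume "{..<n} \<subseteq> supp X"
      then have "supp (?p X1) \<subset> supp X" using p_less[OF X1(4)] by blast
      moreover have "?p X1 \<in> C' - {\<lambda>_. 0}" using X1 p_nonzero by (auto simp: C'_def)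
      ultimately show False using that unfolding minsupp_def by blast
    qed
    have C'_orth: "orthogonal {..<n} X Y" if XY: "X \<in> minsupp C'" "Y \<in> D'" for X Y
    proof -
      obtain X' where X': "X = ?p X'" "X' \<in> C" "supp X' \<subseteq> S \<union> A"
        using XY(1) unfolding minsupp_def C'_def by blast
      obtain Y' where Y': "Y = ?p Y'" "Y' \<in> D" "supp Y' \<inter> A = {}" using XY(2) unfolding D'_def by blast
      have "\<not> S \<subseteq> supp X'"
        using not_all[OF XY(1)] g unfolding X'(1) by (auto simp: supp_pull bij_betw_def)
      then show ?thesis using p_small X' Y' by blast
    qed
    have C'_not1: "supp X \<inter> supp Y \<noteq> {i}" if XY: "X \<in> C'" "Y \<in> D'" for X Y i
    proof
      assume single: "supp X \<inter> supp Y = {i}"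
      obtain X' where X': "X = ?p X'" "X' \<in> C" "supp X' \<subseteq> S \<union> A" using XY(1) unfolding C'_def by blast
      obtain Y' where Y': "Y = ?p Y'" "Y' \<in> D" "supp Y' \<inter> A = {}" using XY(2) unfolding D'_def by blast
      have "g ` (supp X \<inter> supp Y) = supp X' \<inter> supp Y'"
        using X' Y' g SA by (fastforce simp: supp_pull bij_betw_def)
      then show False using single not1[OF X'(2) Y'(2), of "g i"] by simp
    qed
    have C'_sub: "C' \<subseteq> funspace {..<n}" and D'_sub: "D' \<subseteq> funspace {..<n}"
      by (auto simp: C'_def D'_def pull_in_funspace)
    interpret N: orthogonal_dual_pair "{..<n}" "minsupp C'" D'
    proof
      show "minsupp C' \<subseteq> funspace {..<n}" using C'_sub by (auto simp: minsupp_def)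
      have paint': "painting {..<n} C' D'" unfolding C'_def D'_def by (rule painting_pull[OF paint g SE SA])
      show "painting {..<n} (minsupp C') D'"
        by (rule painting_minsupp[OF _ C'_sub paint' C'_not1]) auto
      show "supp X = supp X'" if "X \<in> minsupp C'" "X' \<in> minsupp C'" "supp X \<subseteq> supp X'" for X X'
        using that unfolding minsupp_def by blast
      show "(\<lambda>e. a * X e) \<in> minsupp C'" if X: "X \<in> minsupp C'" and a: "a \<noteq> 0" for X a
      proof -
        obtain X' where X': "X = ?p X'" "X' \<in> C" "supp X' \<subseteq> S \<union> A"
          using X unfolding minsupp_def C'_def by blast
        have "(\<lambda>e. a * X e) = ?p (\<lambda>e. a * X' e)" by (auto simp: X'(1) pull_def)
        then have "(\<lambda>e. a * X e) \<in> C'" using X' scale a by (auto simp: C'_def supp_scale)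
        then show ?thesis
          using X a by (simp add: minsupp_def supp_scale flip: supp_eq_empty)
      qed
    qed (use C'_orth D'_sub in \<open>auto simp: minsupp_def\<close>)
    have "?p Y0 \<in> covectors {..<n} (minsupp C')"
      using C'_orth less.prems(2) A(2) orthogonal_commute pull_in_funspace
      unfolding covectors_def D'_def by blast
    moreover have "?p X0 \<in> vectors {..<n} (minsupp C')"
      unfolding vectors_def
    proof (intro CollectI conjI ballI pull_in_funspace)
      fix W assume W: "W \<in> cocircuits {..<n} (minsupp C')"
      then obtain Y a where Y: "Y \<in> D'" "supp Y = supp W" "W = (\<lambda>e. a * Y e)"
        by (rule N.cocircuit_from_dual)
      obtain Y' where Y': "Y = ?p Y'" "Y' \<in> D" "supp Y' \<inter> A = {}" using Y(1) unfolding D'_def by blast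
      \<comment> \<open>\<open>Y1\<close> plays the dual role: it prevents the cocircuit
        \<open>W\<close> from having full support, so \<open>X0\<close> and \<open>Y'\<close> have
        fewer common elements than \<open>X0\<close> and \<open>Y0\<close>.\<close>
      have "?p Y1 \<in> covectors {..<n} (minsupp C')"
        using C'_orth Y1(1,2) orthogonal_commute pull_in_funspace
        unfolding covectors_def D'_def by blast
      then have "\<not> supp (?p Y1) \<subset> supp W"
        using W p_nonzero[OF Y1(3)] unfolding cocircuits_def by blast
      then have "\<not> {..<n} \<subseteq> supp Y" using p_less[OF Y1(4)] Y(2) by blast
      then have "\<not> S \<subseteq> supp Y'" using g unfolding Y'(1) by (auto simp: supp_pull bij_betw_def)
      then have "orthogonal {..<n} (?p X0) Y" using p_small[of X0 Y'] less.prems(1) A(1) Y' by blast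
      then show "orthogonal {..<n} (?p X0) W"
        unfolding Y(3) using orthogonal_scale orthogonal_commute by metis
    qed
    ultimately have "orthogonal {..<n} (?p X0) (?p Y0)"
      using perfect N.strong unfolding perfect_hyperfield_def by blast
    then show ?thesis using p_orth A by blast
  qed
qed

theorem theorem5p4:
  fixes E :: "'e set" and C :: "('e \<Rightarrow> 'f::hyperfield) set"
  assumes "perfect_hyperfield TYPE('f)"
    and "weak_matroid E C"
  shows "strong_matroid E C"
proof -
  interpret weak_circuits E C using assms(2) by unfold_locales
  \<comment> \<open>Minimal supports make \<open>D\<close> a clutter, which the choice of the minor
    relies on.\<close>
  define D where "D = minsupp weak_dual"
  have dual_sub: "weak_dual \<subseteq> funspace E" by (auto simp: weak_dual_def)
  then have D_sub: "D \<subseteq> funspace E" by (auto simp: D_def minsupp_def)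
  \<comment> \<open>Minimality is now imposed on the dual side, so the painting is turned around and
    back again.\<close>
  have "painting E D C"
    unfolding D_def
    using finite_ground dual_sub painting_swap[OF C_sub dual_sub painting_weak_dual]
    by (rule painting_minsupp) (metis Int_commute weak_dual_neq_singleton)
  then have paint: "painting E C D" by (rule painting_swap[OF D_sub C_sub])
  have orth: "orthogonal E X Y" if "X \<in> C" "Y \<in> D" for X Y
  proof (rule perfect_imp_orthogonal[OF assms(1) finite_ground C_sub D_sub paint _ _ _ _ that])
    show "supp Y = supp Y'" if "Y \<in> D" "Y' \<in> D" "supp Y \<subseteq> supp Y'" for Y Y'
      using that unfolding D_def minsupp_def by blast
    show "orthogonal E X Y" if "X \<in> C" "Y \<in> D" "card (supp X \<inter> supp Y) \<le> 3" for X Y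
      using that by (simp add: D_def minsupp_def weak_dual_def)
  qed (fact scale_mem supp_clutter)+
  interpret orthogonal_dual_pair E C D
  proof
    show "(\<lambda>_. 0) \<notin> C" using supp_nonempty[of "\<lambda>_. 0"] by (auto simp: supp_def)
  qed (fact finite_ground C_sub D_sub paint orth supp_clutter scale_mem)+
  show ?thesis by (rule strong)
qed

end
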